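(* Let $-\pi/2<\lambda<\pi/2$ and let $f\in\mathcal{R}_{\lambda}$. Then \[ \frac{zf'(z)}{f(z)}\prec\frac{zf_{\lambda}'(z)}{f_{\lambda}(z)}\quad\text{in } |z|<R_{1}(\lambda), \] where \[ R_{1}(\lambda)=\sup\{r<1 :\ Q_{\lambda}(rz)\prec P_{\lambda}(rz)\ \text{in } \mathbb{D}\}. \]
   Context: $\mathbb{D}=\{z\in\mathbb{C}:|z|<1\}$. For analytic functions $g,G$ on $\mathbb{D}$, $g$ is subordinate to $G$ in $\mathbb{D}$, written $g\prec G$ or $g(z)\prec G(z)$, if there is an analytic function $\omega$ on $\mathbb{D}$ with $\omega(0)=0$, $|\omega(z)|<1$ and $g(z)=G(\omega(z))$ for all $z\in\mathbb{D}$. For $0<R\le 1$, "$g(z)\prec G(z)$ in $|z|<R$" means that $z\mapsto g(Rz)$ is subordinate to $z\mapsto G(Rz)$ in $\mathbb{D}$. A subordination includes the requirement that the functions involved are analytic in the disc in question (with removable singularities removed, so $zf'(z)/f(z)$ takes the value $1$ at $z=0$). The values $r$ in the definition of $R_1(\lambda)$ are in $(0,1)$. For $-\pi/2<\lambda<\pi/2$, $\mathcal{R}_\lambda$ (the $\lambda$-Robertson functions) is the set of analytic functions $f$ on $\mathbb{D}$ with $f(0)=0$, $f'(0)=1$ such that $P_f(z)=1+\dfrac{zf''(z)}{f'(z)}$ is analytic in $\mathbb{D}$ and $\operatorname{Re}\big(e^{-i\lambda}P_f(z)\big)>0$ for all $z\in\mathbb{D}$. Further, \[ f_{\lambda}(z)=\frac{(1-z)^{1-2e^{i\lambda}\cos\lambda}-1}{2e^{i\lambda}\cos\lambda-1},\qquad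 P_{\lambda}(z)=1+\frac{zf_\lambda''(z)}{f_\lambda'(z)}=\frac{1+e^{2i\lambda}z}{1-z}, \] \[ Q_{\lambda}(z)=\frac{zf_\lambda'(z)}{f_\lambda(z)}=\frac{e^{2i\lambda}z}{1-z-(1-z)^{1+e^{2i\lambda}}},\qquad Q_\lambda(0)=1, \] where powers of $1-z$ are taken with the principal branch (value $1$ at $z=0$). *)

theory Defs
  imports "HOL-Complex_Analysis.Complex_Analysis"
begin

abbreviation unit_disc :: "complex set" where
  "unit_disc \<equiv> ball 0 1"

definition subordinate :: "(complex \<Rightarrow> complex) \<Rightarrow> (complex \<Rightarrow> complex) \<Rightarrow> bool" where
  "subordinate g G \<longleftrightarrow>
     g holomorphic_on unit_disc \<and> G holomorphic_on unit_disc \<and>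
     (\<exists>\<omega>. \<omega> holomorphic_on unit_disc \<and> \<omega> 0 = 0 \<and>
          (\<forall>z\<in>unit_disc. norm (\<omega> z) < 1 \<and> g z = G (\<omega> z)))"

definition subordinate_in :: "real \<Rightarrow> (complex \<Rightarrow> complex) \<Rightarrow> (complex \<Rightarrow> complex) \<Rightarrow> bool" where
  "subordinate_in R g G \<longleftrightarrow>
     subordinate (\<lambda>z. g (of_real R * z)) (\<lambda>z. G (of_real R * z))"

text \<open>
  Both operators below are total functions, with \<open>x / 0 = 0\<close> at zeros of the denominator.
  For \<open>f\<close> holomorphic on the unit disc with \<open>f 0 = 0\<close> and \<open>f' 0 = 1\<close>, such a zero at a point
  \<open>z \<noteq> 0\<close> is a simple pole of the quotient, so the conventional value there does not make the
  function holomorphic: holomorphy on a disc around \<open>0\<close> still says that \<open>f'\<close> (respectively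
  \<open>f\<close>, apart from \<open>0\<close>) has no zero in it.  The singularity of \<open>z f' / f\<close> at \<open>0\<close> is removable
  with value \<open>1\<close>.
\<close>

definition conv_quot :: "(complex \<Rightarrow> complex) \<Rightarrow> complex \<Rightarrow> complex" where
  "conv_quot f z = 1 + z * deriv (deriv f) z / deriv f z"

definition star_quot :: "(complex \<Rightarrow> complex) \<Rightarrow> complex \<Rightarrow> complex" where
  "star_quot f z = (if z = 0 then 1 else z * deriv f z / f z)"

definition robertson :: "real \<Rightarrow> (complex \<Rightarrow> complex) set" where
  "robertson l = {f. f holomorphic_on unit_disc \<and> f 0 = 0 \<and> deriv f 0 = 1 \<and>
     conv_quot f holomorphic_on unit_disc \<and>
     (\<forall>z\<in>unit_disc. Re (exp (- \<i> * of_real l) * conv_quot f z) > 0)}"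

definition f_rob :: "real \<Rightarrow> complex \<Rightarrow> complex" where
  "f_rob l z =
     ((1 - z) powr (1 - 2 * exp (\<i> * of_real l) * of_real (cos l)) - 1)
       / (2 * exp (\<i> * of_real l) * of_real (cos l) - 1)"

definition P_rob :: "real \<Rightarrow> complex \<Rightarrow> complex" where
  "P_rob l = conv_quot (f_rob l)"

definition Q_rob :: "real \<Rightarrow> complex \<Rightarrow> complex" where
  "Q_rob l = star_quot (f_rob l)"

text \<open>
  The supremum is over a nonempty subset of \<open>(0, 1)\<close>: \<open>P_rob l\<close> is injective near \<open>0\<close>, and
  \<open>Q_rob l\<close> has the same value and half the derivative there, so every small \<open>r\<close> belongs to it.
\<close>

definition R1 :: "real \<Rightarrow> real" where
  "R1 l = Sup {r. 0 < r \<and> r < 1 \<and>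
             subordinate (\<lambda>z. Q_rob l (of_real r * z)) (\<lambda>z. P_rob l (of_real r * z))}"

text \<open>Closed forms of \<open>f_rob\<close>, \<open>P_rob\<close> and \<open>Q_rob\<close>.\<close>

lemma exp_cos_eq: "2 * exp (\<i> * of_real l) * of_real (cos l) - 1 = exp (2 * \<i> * of_real l)"
proof -
  have "2 * of_real (cos l) = exp (\<i> * of_real l) + exp (- (\<i> * of_real l))"
    by (simp add: cos_of_real [symmetric] cos_exp_eq)
  then have "exp (\<i> * of_real l) * (2 * of_real (cos l)) =
      exp (\<i> * of_real l + \<i> * of_real l) + exp (\<i> * of_real l + - (\<i> * of_real l))"
    unfolding exp_add by (simp only: distrib_left)
  then show ?thesis
    by (simp add: algebra_simps)
qed

lemma f_rob_eq:
  "f_rob l z = ((1 - z) powr (- exp (2 * \<i> * of_real l)) - 1) / exp (2 * \<i> * of_real l)"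
  using exp_cos_eq [of l] unfolding f_rob_def
  by (metis (no_types) minus_diff_eq)

lemma one_minus_notin_nonpos: "z \<in> unit_disc \<Longrightarrow> 1 - z \<notin> \<real>\<^sub>\<le>\<^sub>0"
  using complex_Re_le_cmod [of z] by (simp add: complex_nonpos_Reals_iff)

lemma has_deriv_powr:
  assumes "z \<in> unit_disc"
  shows "((\<lambda>z. (1 - z) powr a) has_field_derivative - a * (1 - z) powr (a - 1)) (at z)"
  using one_minus_notin_nonpos [OF assms] by (auto intro!: derivative_eq_intros)

lemma deriv_f_rob:
  assumes "z \<in> unit_disc"
  shows "deriv (f_rob l) z = (1 - z) powr (- exp (2 * \<i> * of_real l) - 1)"
  unfolding f_rob_eq [abs_def]
  by (rule DERIV_imp_deriv)
    (rule derivative_eq_intros has_deriv_powr assms refl | simp add: algebra_simps)+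

lemma deriv2_f_rob:
  assumes "z \<in> unit_disc"
  shows "deriv (deriv (f_rob l)) z =
    (exp (2 * \<i> * of_real l) + 1) * (1 - z) powr (- exp (2 * \<i> * of_real l) - 2)"
proof -
  let ?c = "exp (2 * \<i> * of_real l) :: complex"
  have "eventually (\<lambda>w. w \<in> unit_disc) (nhds z)"
    using assms by (intro eventually_nhds_in_open) auto
  then have "eventually (\<lambda>w. deriv (f_rob l) w = (1 - w) powr (- ?c - 1)) (nhds z)"
    by eventually_elim (rule deriv_f_rob)
  then have "deriv (deriv (f_rob l)) z = deriv (\<lambda>w. (1 - w) powr (- ?c - 1)) z"
    by (intro deriv_cong_ev) auto
  also have "\<dots> = - (- ?c - 1) * (1 - z) powr (- ?c - 1 - 1)"
    by (rule DERIV_imp_deriv, rule has_deriv_powr, rule assms)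
  finally show ?thesis by (simp add: algebra_simps)
qed

lemma P_rob_eq:
  assumes "z \<in> unit_disc"
  shows "P_rob l z = (1 + exp (2 * \<i> * of_real l) * z) / (1 - z)"
proof -
  let ?c = "exp (2 * \<i> * of_real l) :: complex"
  have nz: "1 - z \<noteq> 0" using assms by auto
  have "(1 - z) powr (- ?c - 1) = (1 - z) powr ((- ?c - 2) + 1)"
    by (rule arg_cong [where f = "\<lambda>a. (1 - z) powr a"]) simp
  also have "\<dots> = (1 - z) powr (- ?c - 2) * (1 - z)"
    unfolding powr_add using nz by simp
  finally have e: "(1 - z) powr (- ?c - 1) = (1 - z) powr (- ?c - 2) * (1 - z)" .
  have "P_rob l z = 1 + z * (?c + 1) / (1 - z)"
    unfolding P_rob_def conv_quot_def deriv_f_rob [OF assms] deriv2_f_rob [OF assms] e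
    using nz by simp
  then show ?thesis using nz by (simp add: field_simps)
qed

lemma Q_rob_eq:
  assumes "z \<in> unit_disc" "z \<noteq> 0"
  shows "Q_rob l z = exp (2 * \<i> * of_real l) * z
           / (1 - z - (1 - z) powr (1 + exp (2 * \<i> * of_real l)))"
proof -
  let ?c = "exp (2 * \<i> * of_real l) :: complex"
  define u where "u = (1 - z) powr (1 + ?c)"
  have nz: "1 - z \<noteq> 0" using assms by auto
  have u0: "u \<noteq> 0" using nz by (simp add: u_def)
  have "(1 - z) powr (- ?c - 1) = (1 - z) powr (- (1 + ?c))"
    by (rule arg_cong [where f = "\<lambda>a. (1 - z) powr a"]) simp
  also have "\<dots> = 1 / u" by (simp only: u_def powr_minus_divide)
  finally have a: "(1 - z) powr (- ?c - 1) = 1 / u" .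
  have "(1 - z) powr (- ?c) = (1 - z) powr (1 + (- ?c - 1))" by simp
  also have "\<dots> = (1 - z) / u" unfolding powr_add a using nz by simp
  finally have b: "(1 - z) powr (- ?c) = (1 - z) / u" .
  have "Q_rob l z = z * (1 / u) / (((1 - z) / u - 1) / ?c)"
    unfolding Q_rob_def star_quot_def deriv_f_rob [OF assms(1)] f_rob_eq a b
    using assms(2) by simp
  also have "(1 - z) / u - 1 = (1 - z - u) / u" using u0 by (simp add: diff_divide_distrib)
  also have "z * (1 / u) / ((1 - z - u) / u / ?c) = ?c * z / (1 - z - u)"
    using u0 by (simp add: mult.commute)
  finally show ?thesis by (simp add: u_def)
qed

lemma Q_rob_0: "Q_rob l 0 = 1"
  by (simp add: Q_rob_def star_quot_def)

end

theory Submission imports Defs begin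

text \<open>
  Put \<open>c = exp (2 \<i> l)\<close>, \<open>a = 1 + c\<close> and \<open>H z = 1 + a z / (1 - z)\<close>.  The quotients \<open>p = z f' / f\<close> and
  \<open>q = z k' / k\<close>, where \<open>k\<close> is the extremal function \<open>f_rob l\<close>, satisfy Briot-Bouquet equations
  with the right-hand sides \<open>1 + z f'' / f'\<close> and \<open>1 + z k'' / k'\<close>:
  \<open>p + z p' / p = H \<circ> \<phi>\<close> with \<open>norm (\<phi> z) \<le> norm z\<close>, because \<open>f\<close> is a Robertson function and \<open>H\<close>
  maps the disc onto the tilted half-plane, and \<open>q + z q' / q = H\<close>.  The definition of \<open>R1 l\<close>
  provides the values of \<open>q\<close> on \<open>ball 0 (R1 l) - {0}\<close> in the form \<open>q w = H v\<close> with \<open>norm v < norm w\<close>;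
  the inequality is strict since \<open>q\<close> has only half the derivative of \<open>H\<close> at \<open>0\<close>.

  The proof rests on the convexity of the images under \<open>H\<close> of discs around \<open>0\<close>, mainly through one
  estimate (\<open>halfplane_support\<close>): for \<open>norm v \<le> norm w\<close> and \<open>v \<noteq> w\<close>, the vector \<open>H w - H v\<close>
  makes an acute angle with the outer normal \<open>w H' w\<close> at \<open>H w\<close>.  It is used twice.

  First, \<open>F = log q\<close> satisfies \<open>w F' w = H w - q w\<close>, so the real part of \<open>F' / H'\<close> is positive.
  Hence \<open>F \<circ> H\<inverse>\<close> has a derivative with positive real part on a convex set, and \<open>F\<close> is injective.
  This does not give the injectivity of \<open>q\<close> itself, but that of its logarithm suffices: \<open>\<omega> = F\<inverse> \<circ> log p\<close> is a candidate for the subordinating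
  function wherever \<open>log p\<close> takes values in the image of \<open>F\<close>.

  Second, \<open>norm (\<omega> z) \<le> norm z\<close> (\<open>norm_le_of_ode\<close>).  At a point where \<open>norm \<omega>\<close> is maximal on its
  circle, Jack's lemma gives \<open>z \<omega>' = m \<omega>\<close> with a real \<open>m \<ge> 1\<close>.  The two equations then read
  \<open>H (\<phi> z) = H w + (m - 1) (H w - q w)\<close> with \<open>w = \<omega> z\<close>.  If \<open>norm w > norm z\<close>, the supporting line at
  \<open>H w\<close> separates the two sides.

  It remains to see that \<open>\<omega>\<close> exists on all of \<open>ball 0 (R1 l)\<close>, in particular that \<open>f\<close> vanishes there
  only at \<open>0\<close> (\<open>dominates_star_quot\<close>).  The bound on \<open>\<omega>\<close> confines the values of \<open>log p\<close> on a smaller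
  disc to a compact subset of the image of \<open>F\<close>, so that neither a pole of \<open>p\<close> nor the
  boundary of this image can stop the continuation to a larger disc.
\<close>

section \<open>The half-plane map and convexity\<close>

lemma Re_sum_divide_diff:
  fixes x y :: complex
  shows "Re ((x + y) / (x - y)) = ((norm x)\<^sup>2 - (norm y)\<^sup>2) / (norm (x - y))\<^sup>2"
  unfolding cmod_power2 Re_divide
  by (rule arg_cong2 [where f = "(/)"]) (simp_all add: power2_eq_square algebra_simps)

text \<open>
  Geometrically, \<open>w \<mapsto> w / (1 - w)\<close> maps the closed disc of radius \<open>norm w\<close> onto a closed disc
  \<open>K\<close>, and the quotient below is the vector from the image of \<open>v\<close>, a point of \<open>K\<close>, to the image
  of \<open>w\<close>, a boundary point of \<open>K\<close>, divided by the outer normal of \<open>K\<close> at the latter.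
\<close>

lemma halfplane_support:
  fixes v w :: complex
  assumes "norm v \<le> norm w" "norm w < 1" "v \<noteq> w"
  shows "Re ((w - v) * (1 - w) / (w * (1 - v))) > 0"
proof -
  define T where "T = (w - v) * (1 - w) / (w * (1 - v))"
  have nz: "w \<noteq> 0" "1 - w \<noteq> 0" "1 - v \<noteq> 0" "w - v \<noteq> 0"
    using assms by auto
  have T0: "T \<noteq> 0"
    using nz by (simp add: T_def)
  have "2 * inverse T = (1 + w) / (1 - w) + (w + v) / (w - v)"
    using nz unfolding T_def by (simp add: divide_simps) (simp add: algebra_simps)
  then have e: "2 * Re (inverse T) = Re ((1 + w) / (1 - w)) + Re ((w + v) / (w - v))"
    by (metis Re_complex_of_real mult_2 plus_complex.sel(1))
  have "(norm w)\<^sup>2 < 1"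
    using assms(2) by (simp add: power_less_one_iff abs_square_less_1)
  then have "Re ((1 + w) / (1 - w)) > 0"
    unfolding Re_sum_divide_diff using nz by simp
  moreover have "(norm v)\<^sup>2 \<le> (norm w)\<^sup>2"
    using assms(1) by (intro power_mono) auto
  then have "Re ((w + v) / (w - v)) \<ge> 0"
    unfolding Re_sum_divide_diff by simp
  ultimately have "Re (inverse T) > 0"
    using e by linarith
  moreover have "Re (inverse T) = Re T / (norm T)\<^sup>2"
    by (simp only: inverse_complex.sel(1) cmod_power2)
  ultimately have "Re T > 0"
    using T0 by (simp only: zero_less_divide_iff) auto
  then show ?thesis
    by (simp add: T_def)
qed

definition halfplane_map :: "complex \<Rightarrow> complex \<Rightarrow> complex" where
  "halfplane_map a z = 1 + a * (z / (1 - z))"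

lemma halfplane_map_diff:
  assumes "w \<noteq> 1" "v \<noteq> 1"
  shows "halfplane_map a w - halfplane_map a v = a * (w - v) / ((1 - w) * (1 - v))"
  using assms by (simp add: halfplane_map_def divide_simps) (simp add: algebra_simps)

lemma halfplane_map_has_field_derivative:
  assumes "z \<noteq> 1"
  shows "(halfplane_map a has_field_derivative a / (1 - z)\<^sup>2) (at z)"
  unfolding halfplane_map_def [abs_def] using assms
  by (auto intro!: derivative_eq_intros simp: power2_eq_square field_simps)

lemma halfplane_map_holomorphic: "halfplane_map a holomorphic_on unit_disc"
  unfolding halfplane_map_def [abs_def] by (auto intro!: holomorphic_intros)

text \<open>
  In the coordinate \<open>s = z / (1 - z)\<close> the condition \<open>norm z < R\<close> becomes \<open>norm s < R * norm (1 + s)\<close>.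
  After squaring, this bounds a function of \<open>s\<close> that is convex for \<open>R \<le> 1\<close>.
\<close>

lemma convex_image_ball:
  assumes "0 < R" "R \<le> 1"
  shows "convex ((\<lambda>z::complex. z / (1 - z)) ` ball 0 R)"
proof -
  define S where "S = {s::complex. (1 - R\<^sup>2) * (norm s)\<^sup>2 - 2 * R\<^sup>2 * Re s < R\<^sup>2}"
  have S_eq: "s \<in> S \<longleftrightarrow> (norm s)\<^sup>2 < (R * norm (1 + s))\<^sup>2" for s
    unfolding S_def by (simp add: power_mult_distrib cmod_power2) (simp add: power2_eq_square algebra_simps)
  have S_eq': "s \<in> S \<longleftrightarrow> norm s < R * norm (1 + s)" for s
    unfolding S_eq using assms by (auto intro: power_strict_mono dest: power_less_imp_less_base)
  have "(\<lambda>z::complex. z / (1 - z)) ` ball 0 R = S"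
  proof (intro set_eqI iffI)
    fix s assume "s \<in> (\<lambda>z::complex. z / (1 - z)) ` ball 0 R"
    then obtain z where z: "norm z < R" "s = z / (1 - z)" by auto
    have nz: "1 - z \<noteq> 0" using z assms by auto
    have "1 + s = 1 / (1 - z)" using nz z by (simp add: field_simps)
    then show "s \<in> S"
      using z nz by (simp add: S_eq' norm_divide divide_strict_right_mono)
  next
    fix s assume s: "s \<in> S"
    then have nz: "1 + s \<noteq> 0" unfolding S_eq' by auto
    have "norm (s / (1 + s)) < R"
      using s nz unfolding S_eq' by (simp add: norm_divide divide_less_eq)
    moreover have "1 - s / (1 + s) = 1 / (1 + s)"
      using nz by (simp add: field_simps)
    then have "s = (s / (1 + s)) / (1 - s / (1 + s))"
      using nz by simp
    ultimately show "s \<in> (\<lambda>z::complex. z / (1 - z)) ` ball 0 R"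
      by (intro image_eqI [of _ _ "s / (1 + s)"]) auto
  qed
  moreover have "convex S"
  proof (rule convexI)
    fix x y :: complex and u v :: real
    assume xy: "x \<in> S" "y \<in> S" and uv: "0 \<le> u" "0 \<le> v" "u + v = 1"
    have "(norm (u *\<^sub>R x + v *\<^sub>R y))\<^sup>2 \<le> (u * norm x + v * norm y)\<^sup>2"
      using uv norm_triangle_ineq [of "u *\<^sub>R x" "v *\<^sub>R y"] by (intro power_mono) auto
    also have "\<dots> = u * (norm x)\<^sup>2 + v * (norm y)\<^sup>2 - u * v * (norm x - norm y)\<^sup>2"
    proof -
      have v: "v = 1 - u" using uv by simp
      show ?thesis unfolding v by (simp add: power2_eq_square algebra_simps)
    qed
    also have "\<dots> \<le> u * (norm x)\<^sup>2 + v * (norm y)\<^sup>2"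
      using uv by simp
    finally have n: "(norm (u *\<^sub>R x + v *\<^sub>R y))\<^sup>2 \<le> u * (norm x)\<^sup>2 + v * (norm y)\<^sup>2" .
    have "R\<^sup>2 \<le> 1" using assms by (simp add: power_le_one)
    then have "(1 - R\<^sup>2) * (norm (u *\<^sub>R x + v *\<^sub>R y))\<^sup>2 - 2 * R\<^sup>2 * Re (u *\<^sub>R x + v *\<^sub>R y)
      \<le> (1 - R\<^sup>2) * (u * (norm x)\<^sup>2 + v * (norm y)\<^sup>2) - 2 * R\<^sup>2 * Re (u *\<^sub>R x + v *\<^sub>R y)"
      using n by (intro diff_right_mono mult_left_mono) auto
    also have "\<dots> = u * ((1 - R\<^sup>2) * (norm x)\<^sup>2 - 2 * R\<^sup>2 * Re x)
        + v * ((1 - R\<^sup>2) * (norm y)\<^sup>2 - 2 * R\<^sup>2 * Re y)"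
      by (simp add: algebra_simps)
    also have "\<dots> < R\<^sup>2"
      using xy uv unfolding S_def by (intro convex_bound_lt) auto
    finally show "u *\<^sub>R x + v *\<^sub>R y \<in> S" unfolding S_def by simp
  qed
  ultimately show ?thesis by simp
qed

text \<open>
  Along the segment from \<open>a\<close> to \<open>b\<close>, the real part of \<open>f / (b - a)\<close> is strictly increasing.
\<close>

lemma inj_on_of_Re_deriv_pos:
  fixes f :: "complex \<Rightarrow> complex"
  assumes "convex S"
    and der: "\<And>z. z \<in> S \<Longrightarrow> (f has_field_derivative f' z) (at z)"
    and pos: "\<And>z. z \<in> S \<Longrightarrow> Re (f' z) > 0"
  shows "inj_on f S"
proof (rule inj_onI, rule ccontr)
  fix a b assume ab: "a \<in> S" "b \<in> S" "f a = f b" "a \<noteq> b"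
  define g where "g t = Re (f (a + of_real t * (b - a)) / (b - a))" for t :: real
  have "g 0 < g 1"
  proof (rule DERIV_pos_imp_increasing [where f = g and a = 0 and b = 1])
    fix t :: real assume t: "0 \<le> t" "t \<le> 1"
    have "(1 - t) *\<^sub>R a + t *\<^sub>R b \<in> S"
      using ab t assms(1) by (intro convexD) auto
    moreover have "(1 - t) *\<^sub>R a + t *\<^sub>R b = a + of_real t * (b - a)"
      by (simp add: scaleR_conv_of_real algebra_simps)
    ultimately have S: "a + of_real t * (b - a) \<in> S" by simp
    have "((\<lambda>w. f (a + w * (b - a)) / (b - a)) has_field_derivative
        f' (a + of_real t * (b - a))) (at (of_real t))"
    proof -
      have "((\<lambda>w. f (a + w * (b - a))) has_field_derivative f' (a + of_real t * (b - a)) * (b - a))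
          (at (of_real t))"
        by (rule DERIV_chain2 [where g = "\<lambda>w. a + w * (b - a)", OF der [OF S]])
          (auto intro!: derivative_eq_intros)
      from DERIV_cdivide [OF this, of "b - a"]
      show "((\<lambda>w. f (a + w * (b - a)) / (b - a)) has_field_derivative
          f' (a + of_real t * (b - a))) (at (of_real t))"
        using ab by simp
    qed
    then have "((\<lambda>t. f (a + of_real t * (b - a)) / (b - a)) has_vector_derivative
        f' (a + of_real t * (b - a))) (at t)"
      by (rule has_vector_derivative_real_field)
    then have "(g has_real_derivative Re (f' (a + of_real t * (b - a)))) (at t)"
      unfolding g_def [abs_def] has_real_derivative_iff_has_vector_derivative
      by (rule bounded_linear.has_vector_derivative [OF bounded_linear_Re])
    then show "\<exists>y. (g has_real_derivative y) (at t) \<and> 0 < y"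
      using pos [OF S] by blast
  qed simp
  then show False
    using ab by (simp add: g_def)
qed

text \<open>
  The hypothesis says that \<open>F\<close> is close-to-convex with respect to the half-plane map: in the
  coordinate \<open>s = z / (1 - z)\<close>, which ranges over a convex set, the derivative of \<open>F\<close> divided
  by \<open>a\<close> has positive real part.
\<close>

lemma inj_on_of_close_to_convex:
  assumes R: "0 < R" "R \<le> 1" and "a \<noteq> 0"
    and F: "F holomorphic_on ball 0 R"
    and pos: "\<And>w. w \<in> ball 0 R \<Longrightarrow> Re (deriv F w * (1 - w)\<^sup>2 / a) > 0"
  shows "inj_on F (ball 0 R)"
proof -
  let ?s = "\<lambda>z::complex. z / (1 - z)"
  let ?S = "?s ` ball 0 R"
  let ?t = "\<lambda>s::complex. s / (1 + s)"
  have ts: "?t (?s z) = z" "1 + ?s z = 1 / (1 - z)" "1 - z \<noteq> 0" if "z \<in> ball 0 R" for z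
  proof -
    show nz: "1 - z \<noteq> 0" using that R by auto
    show *: "1 + ?s z = 1 / (1 - z)" using nz by (simp add: field_simps)
    show "?t (?s z) = z" unfolding * using nz by simp
  qed
  have "inj_on (\<lambda>s. F (?t s) / a) ?S"
  proof (rule inj_on_of_Re_deriv_pos [where f' = "\<lambda>s. deriv F (?t s) * (1 - ?t s)\<^sup>2 / a"])
    show "convex ?S" by (rule convex_image_ball [OF R])
  next
    fix s assume "s \<in> ?S"
    then obtain z where z: "z \<in> ball 0 R" "s = ?s z" by auto
    have tz: "?t s = z" and nz: "1 + s \<noteq> 0" and t1: "1 - ?t s = 1 / (1 + s)"
      using ts [OF z(1)] z(2) by auto
    have "(F has_field_derivative deriv F (?t s)) (at (?t s))"
      using z tz by (intro holomorphic_derivI [OF F]) auto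
    moreover have "(?t has_field_derivative (1 - ?t s)\<^sup>2) (at s)"
      unfolding t1 using nz
      by (auto intro!: derivative_eq_intros simp: power2_eq_square field_simps)
    ultimately show "((\<lambda>s. F (?t s) / a) has_field_derivative deriv F (?t s) * (1 - ?t s)\<^sup>2 / a) (at s)"
      by (intro DERIV_cdivide DERIV_chain2 [of F])
    show "Re (deriv F (?t s) * (1 - ?t s)\<^sup>2 / a) > 0"
      using pos [OF z(1)] tz by simp
  qed
  then have *: "inj_on (\<lambda>z. F (?t (?s z)) / a) (ball 0 R)"
    using comp_inj_on [of ?s "ball 0 R" "\<lambda>s. F (?t s) / a"] inj_on_inverseI [of "ball 0 R" ?t ?s] ts(1)
    by (simp add: comp_def)
  show ?thesis
    using * ts(1) \<open>a \<noteq> 0\<close> by (simp add: inj_on_def)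
qed

section \<open>Local facts about holomorphic functions\<close>

text \<open>
  Jack's lemma: the logarithmic derivative \<open>D\<close> of \<open>\<omega>\<close> at \<open>z0\<close> is the derivative at \<open>1\<close> of
  \<open>G \<zeta> = \<omega> (\<zeta> z0) / \<omega> z0\<close>, and \<open>norm (G \<zeta>) \<le> norm \<zeta>\<close> on the closed unit disc by the maximum
  principle.  As \<open>G 1 = 1\<close>, the real part of \<open>G\<close> is maximal at \<open>1\<close> along the unit circle, so \<open>D\<close> is
  real; and to the left of \<open>1\<close> on the real axis it does not exceed the identity, so \<open>Re D \<ge> 1\<close>.
\<close>

lemma Jack:
  assumes hol: "\<omega> holomorphic_on ball 0 \<rho>" and "\<omega> 0 = 0"
    and z0: "z0 \<in> ball 0 \<rho>" "\<omega> z0 \<noteq> 0"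
    and mx: "\<And>z. norm z = norm z0 \<Longrightarrow> norm (\<omega> z) \<le> norm (\<omega> z0)"
  obtains m :: real where "m \<ge> 1" "z0 * deriv \<omega> z0 = of_real m * \<omega> z0"
proof -
  define D where "D = z0 * deriv \<omega> z0 / \<omega> z0"
  define G where "G \<zeta> = \<omega> (\<zeta> * z0) / \<omega> z0" for \<zeta>
  have z00: "z0 \<noteq> 0" using assms by auto
  have G': "(G has_field_derivative D) (at 1)"
  proof -
    have "(\<omega> has_field_derivative deriv \<omega> z0) (at (1 * z0))"
      using z0 by (auto intro!: holomorphic_derivI [OF hol])
    then have "((\<lambda>\<zeta>. \<omega> (\<zeta> * z0)) has_field_derivative deriv \<omega> z0 * z0) (at 1)"
      by (rule DERIV_chain2) (auto intro!: derivative_eq_intros)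
    then show ?thesis
      unfolding G_def [abs_def] D_def by (simp add: DERIV_cdivide mult.commute)
  qed
  have G1: "G 1 = 1" using z0 by (simp add: G_def)
  obtain h where h: "h holomorphic_on ball 0 \<rho>" "\<And>z. norm z < \<rho> \<Longrightarrow> \<omega> z = z * h z"
    using Schwarz3 [OF hol \<open>\<omega> 0 = 0\<close>] by metis
  have hle: "norm (h z) \<le> norm (\<omega> z0) / norm z0" if "norm z \<le> norm z0" for z
  proof (rule maximum_modulus_frontier [of h "cball 0 (norm z0)"])
    show "h holomorphic_on interior (cball 0 (norm z0))"
      using z0 by (auto intro!: holomorphic_on_subset [OF h(1)])
    show "continuous_on (closure (cball 0 (norm z0))) h"
      using z0 by (auto intro!: holomorphic_on_imp_continuous_on holomorphic_on_subset [OF h(1)])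
    fix w :: complex assume "w \<in> frontier (cball 0 (norm z0))"
    then have w: "norm w = norm z0" by auto
    have "norm (\<omega> w) = norm w * norm (h w)"
      using h(2) [of w] z0 w by (simp add: norm_mult)
    then show "norm (h w) \<le> norm (\<omega> z0) / norm z0"
      using mx [OF w] w z00 by (simp add: field_simps)
  qed (use that in auto)
  have Gle: "Re (G \<zeta>) \<le> norm \<zeta>" if "norm \<zeta> \<le> 1" for \<zeta>
  proof -
    have n: "norm (\<zeta> * z0) \<le> norm z0"
      using that z00 by (simp add: norm_mult mult_le_cancel_right1)
    have "norm (\<omega> (\<zeta> * z0)) = norm (\<zeta> * z0) * norm (h (\<zeta> * z0))"
      using h(2) [of "\<zeta> * z0"] n z0 by (simp add: norm_mult)
    also have "\<dots> \<le> norm (\<zeta> * z0) * (norm (\<omega> z0) / norm z0)"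
      by (intro mult_left_mono hle n) auto
    finally have "norm (G \<zeta>) \<le> norm \<zeta>"
      using z0 z00 by (simp add: G_def norm_divide norm_mult field_simps)
    then show ?thesis
      using complex_Re_le_cmod [of "G \<zeta>"] by linarith
  qed
  have "Im D = 0"
  proof -
    have "((\<lambda>\<zeta>. G (exp (\<i> * \<zeta>))) has_field_derivative D * \<i>) (at (of_real 0))"
      using G' by (auto intro!: derivative_eq_intros DERIV_chain2 [of G])
    then have "((\<lambda>t. G (exp (\<i> * of_real t))) has_vector_derivative D * \<i>) (at 0)"
      by (rule has_vector_derivative_real_field)
    then have "((\<lambda>t. Re (G (exp (\<i> * of_real t)))) has_real_derivative Re (D * \<i>)) (at 0)"
      unfolding has_real_derivative_iff_has_vector_derivative
      by (rule bounded_linear.has_vector_derivative [OF bounded_linear_Re])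
    then have "Re (D * \<i>) = 0"
    proof (rule DERIV_local_max [where d = 1])
      have "Re (G (exp (\<i> * of_real t))) \<le> 1" for t :: real
        using Gle [of "exp (\<i> * of_real t)"] by simp
      then show "\<forall>t. \<bar>0 - t\<bar> < 1 \<longrightarrow> Re (G (exp (\<i> * of_real t))) \<le> Re (G (exp (\<i> * of_real 0)))"
        using G1 by simp
    qed simp
    then show ?thesis by simp
  qed
  moreover have "Re D \<ge> 1"
  proof (rule ccontr)
    assume n: "\<not> Re D \<ge> 1"
    have "(G has_field_derivative D) (at (of_real 1))" using G' by simp
    then have "((\<lambda>t. G (of_real t)) has_vector_derivative D) (at 1)"
      by (rule has_vector_derivative_real_field)
    then have "((\<lambda>t. Re (G (of_real t))) has_real_derivative Re D) (at 1)"
      unfolding has_real_derivative_iff_has_vector_derivative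
      by (rule bounded_linear.has_vector_derivative [OF bounded_linear_Re])
    then have "((\<lambda>t. Re (G (of_real t)) - t) has_real_derivative Re D - 1) (at 1)"
      by (rule DERIV_diff [OF _ DERIV_ident])
    from DERIV_neg_dec_left [OF this] n obtain d where d: "d > 0"
      "\<And>h. 0 < h \<Longrightarrow> h < d \<Longrightarrow> Re (G 1) - 1 < Re (G (of_real (1 - h))) - (1 - h)"
      by auto
    define h where "h = min (d / 2) (1 / 2)"
    have "Re (G 1) - 1 < Re (G (of_real (1 - h))) - (1 - h)"
      using d(1) by (intro d(2)) (auto simp: h_def)
    moreover have "norm (complex_of_real (1 - h)) = 1 - h"
      unfolding norm_of_real using d(1) by (auto simp: h_def)
    moreover have "1 - h \<le> 1" using d(1) by (auto simp: h_def)
    ultimately show False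
      using Gle [of "of_real (1 - h)"] G1 by auto
  qed
  moreover have "z0 * deriv \<omega> z0 = D * \<omega> z0"
    using z0 by (simp add: D_def)
  ultimately show ?thesis
    by (intro that [of "Re D"]) (auto simp: complex_eq_iff)
qed

text \<open>
  Division by zero yields \<open>0\<close>, so the quotient alone says nothing at the zeros of \<open>h\<close>; continuation
  from a neighbourhood of a point where \<open>h\<close> does not vanish recovers the identity there.
\<close>

lemma holomorphic_quotient_mult:
  assumes S: "open S" "connected S"
    and hol: "q holomorphic_on S" "g holomorphic_on S" "h holomorphic_on S"
    and w: "w \<in> S" "h w \<noteq> 0"
    and eq: "\<And>z. z \<in> S \<Longrightarrow> q z = g z / h z"
    and z: "z \<in> S"
  shows "q z * h z = g z"
proof -
  define U where "U = S \<inter> h -` (- {0})"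
  have "open U"
    unfolding U_def using hol S
    by (intro continuous_open_preimage holomorphic_on_imp_continuous_on) auto
  then show ?thesis
    by (rule analytic_continuation_open [where s = U and s' = S and f = "\<lambda>z. q z * h z"])
      (use S z w in \<open>auto simp: U_def eq intro!: holomorphic_intros hol\<close>)
qed

text \<open>
  Off the origin, \<open>f'' / f' = (conv_quot f - 1) / z\<close>, and the right-hand side extends to a holomorphic
  function \<open>B\<close>.  The linear equation \<open>f'' = B f'\<close> makes \<open>f'\<close> a constant multiple of an exponential.
\<close>

lemma deriv_nonzero_of_conv_quot:
  assumes f: "f holomorphic_on unit_disc" "deriv f 0 = 1"
    and P: "conv_quot f holomorphic_on unit_disc"
    and z: "z \<in> unit_disc"
  shows "deriv f z \<noteq> 0"
proof -
  have hol': "deriv f holomorphic_on unit_disc" "deriv (deriv f) holomorphic_on unit_disc"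
    using f by (auto intro!: holomorphic_deriv)
  have A: "(conv_quot f w - 1) * deriv f w = w * deriv (deriv f) w" if "w \<in> unit_disc" for w
  proof (rule holomorphic_quotient_mult [where S = unit_disc and w = 0
        and q = "\<lambda>w. conv_quot f w - 1" and h = "deriv f" and g = "\<lambda>w. w * deriv (deriv f) w"])
    show "(\<lambda>w. conv_quot f w - 1) holomorphic_on unit_disc"
      "(\<lambda>w. w * deriv (deriv f) w) holomorphic_on unit_disc"
      using P hol' by (auto intro!: holomorphic_intros)
    show "(0::complex) \<in> unit_disc" "deriv f 0 \<noteq> 0"
      using f by auto
  qed (use hol' that in \<open>auto simp: conv_quot_def\<close>)
  have "(\<lambda>w. conv_quot f w - 1) holomorphic_on ball 0 1"
    by (intro holomorphic_intros P)
  moreover have "conv_quot f 0 - 1 = 0" by (simp add: conv_quot_def)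
  ultimately obtain B where B: "B holomorphic_on unit_disc"
    "\<And>w. norm w < 1 \<Longrightarrow> conv_quot f w - 1 = w * B w"
    by (rule Schwarz3) blast
  have ode: "deriv (deriv f) w = B w * deriv f w" if "w \<in> unit_disc" for w
  proof (rule analytic_continuation_open [where s = "unit_disc - {0}" and s' = unit_disc
        and f = "deriv (deriv f)" and g = "\<lambda>w. B w * deriv f w"])
    have "(1/2 :: complex) \<in> unit_disc - {0}" by simp
    then show "unit_disc - {0} \<noteq> ({} :: complex set)" by blast
    fix w :: complex assume "w \<in> unit_disc - {0}"
    then show "deriv (deriv f) w = B w * deriv f w"
      using A [of w] B(2) [of w] by (auto simp: mult.assoc)
  qed (use hol' B that in \<open>auto intro!: holomorphic_intros\<close>)
  obtain E where E: "\<And>w. w \<in> unit_disc \<Longrightarrow> (E has_field_derivative B w) (at w within unit_disc)"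
    using holomorphic_convex_primitive' [OF _ _ B(1)] by auto
  have "((\<lambda>w. deriv f w * exp (- E w)) has_field_derivative 0) (at w within unit_disc)"
    if "w \<in> unit_disc" for w
  proof -
    have "(deriv f has_field_derivative deriv (deriv f) w) (at w within unit_disc)"
      using holomorphic_derivI [OF hol'(1) _ that] has_field_derivative_at_within by blast
    then show ?thesis
      using E [OF that] by (auto intro!: derivative_eq_intros simp: ode [OF that])
  qed
  then obtain C where C: "\<And>w. w \<in> unit_disc \<Longrightarrow> deriv f w * exp (- E w) = C"
    using has_field_derivative_zero_constant [of unit_disc "\<lambda>w. deriv f w * exp (- E w)"] by auto
  have "C \<noteq> 0" using C [of 0] f by auto
  then show ?thesis using C [OF z] by auto
qed

text \<open>
  The factor \<open>m z = f z / z\<close> replaces \<open>star_quot f\<close> by a quotient of holomorphic functions whose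
  denominator does not vanish at the origin.
\<close>

lemma star_quot_factor:
  assumes f: "f holomorphic_on unit_disc" "f 0 = 0" "deriv f 0 = 1"
  obtains m where "m holomorphic_on unit_disc" "m 0 = 1"
    "\<And>z. z \<in> unit_disc \<Longrightarrow> f z = z * m z"
    "\<And>z. z \<in> unit_disc \<Longrightarrow> star_quot f z = deriv f z / m z"
proof -
  obtain m where m: "m holomorphic_on unit_disc" "\<And>z. norm z < 1 \<Longrightarrow> f z = z * m z" "deriv f 0 = m 0"
    using Schwarz3 [OF f(1,2)] by blast
  show ?thesis
    by (rule that [of m]) (use m f in \<open>auto simp: star_quot_def\<close>)
qed

text \<open>
  With \<open>p = exp L = z f' / f\<close> this is the Briot-Bouquet relation \<open>p + z p' / p = 1 + z f'' / f'\<close>.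
\<close>

lemma log_star_quot_ode:
  assumes f: "f holomorphic_on unit_disc" "\<And>z. z \<in> unit_disc \<Longrightarrow> deriv f z \<noteq> 0"
    and m: "m holomorphic_on unit_disc" "\<And>z. z \<in> unit_disc \<Longrightarrow> f z = z * m z"
    and \<rho>: "\<rho> \<le> 1" and L: "L holomorphic_on ball 0 \<rho>"
    and eq: "\<And>z. z \<in> ball 0 \<rho> \<Longrightarrow> exp (L z) * m z = deriv f z"
    and z: "z \<in> ball 0 \<rho>"
  shows "z * deriv L z + exp (L z) = conv_quot f z"
proof -
  have zD: "z \<in> unit_disc" using z \<rho> by auto
  have m': "(m has_field_derivative deriv m z) (at z)"
    by (rule holomorphic_derivI [OF m(1) _ zD]) simp
  have L': "(L has_field_derivative deriv L z) (at z)"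
    by (rule holomorphic_derivI [OF L _ z]) simp
  have "deriv f z = deriv (\<lambda>z. z * m z) z"
    by (rule complex_derivative_transform_within_open [where s = unit_disc])
      (use f m zD in \<open>auto intro!: holomorphic_intros\<close>)
  also have "\<dots> = m z + z * deriv m z"
    by (rule DERIV_imp_deriv) (auto intro!: derivative_eq_intros m')
  finally have 1: "deriv f z = m z + z * deriv m z" .
  have "deriv (deriv f) z = deriv (\<lambda>z. exp (L z) * m z) z"
    by (rule complex_derivative_transform_within_open [where s = "ball 0 \<rho>"])
      (use f m z L eq \<rho> in \<open>auto intro!: holomorphic_intros
        intro: holomorphic_on_subset [OF m(1)] holomorphic_on_subset [OF f(1)]\<close>)
  also have "\<dots> = exp (L z) * (deriv L z * m z + deriv m z)"
    by (rule DERIV_imp_deriv) (auto intro!: derivative_eq_intros m' L' simp: algebra_simps)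
  finally have 2: "deriv (deriv f) z = exp (L z) * (deriv L z * m z + deriv m z)" .
  have "z * deriv (deriv f) z = exp (L z) * m z * (z * deriv L z) + exp (L z) * (z * deriv m z)"
    unfolding 2 by (simp add: algebra_simps)
  also have "\<dots> = deriv f z * (z * deriv L z) + exp (L z) * (deriv f z - m z)"
    using eq [OF z] 1 by simp
  also have "\<dots> = deriv f z * (z * deriv L z + exp (L z) - 1)"
    using eq [OF z] by (simp add: algebra_simps)
  finally show ?thesis
    using f(2) [OF zD] by (simp add: conv_quot_def)
qed

text \<open>This supplies the logarithm of \<open>z f' / f = f' / m\<close> that takes the value \<open>0\<close> at \<open>0\<close>.\<close>

lemma normalised_log_exists:
  assumes \<rho>: "0 < \<rho>" "\<rho> \<le> 1"
    and f: "f holomorphic_on unit_disc" "deriv f 0 = 1" "\<And>z. z \<in> unit_disc \<Longrightarrow> deriv f z \<noteq> 0"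
    and m: "m holomorphic_on unit_disc" "m 0 = 1"
    and nz: "\<And>z. z \<in> ball 0 \<rho> \<Longrightarrow> m z \<noteq> 0"
  shows "\<exists>L. L holomorphic_on ball 0 \<rho> \<and> L 0 = 0 \<and> (\<forall>z\<in>ball 0 \<rho>. exp (L z) * m z = deriv f z)"
proof -
  have f': "deriv f holomorphic_on unit_disc" by (intro holomorphic_deriv f) auto
  have "(\<lambda>z. deriv f z / m z) holomorphic_on ball 0 \<rho>"
    using \<rho> nz
    by (intro holomorphic_intros holomorphic_on_subset [OF f'] holomorphic_on_subset [OF m(1)]) auto
  then obtain g where g: "g holomorphic_on ball 0 \<rho>"
      "\<And>z. z \<in> ball 0 \<rho> \<Longrightarrow> exp (g z) = deriv f z / m z"
    using holomorphic_logarithm_exists [of "ball 0 \<rho>" "\<lambda>z. deriv f z / m z" 0] nz \<rho> f(3) by auto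
  have g0: "exp (g 0) = 1" using g(2) [of 0] \<rho> m f by simp
  show ?thesis
    by (rule exI [of _ "\<lambda>z. g z - g 0"]) (use g nz g0 in \<open>auto intro!: holomorphic_intros simp: exp_diff\<close>)
qed

text \<open>Both summands on the left of the equation contribute \<open>deriv F 0\<close> to its derivative at \<open>0\<close>.\<close>

lemma log_ode_deriv_0:
  assumes "0 < R" and F: "F holomorphic_on ball 0 R" "F 0 = 0"
    and H: "(H has_field_derivative h) (at 0)"
    and ode: "\<And>w. w \<in> ball 0 R \<Longrightarrow> w * deriv F w + exp (F w) = H w"
  shows "deriv F 0 = h / 2"
proof -
  have F': "(F has_field_derivative deriv F 0) (at 0)"
    using assms by (intro holomorphic_derivI [OF F(1)]) auto
  have F'': "(deriv F has_field_derivative deriv (deriv F) 0) (at 0)"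
    using assms by (intro holomorphic_derivI [OF holomorphic_deriv [OF F(1)]]) auto
  have "((\<lambda>w. w * deriv F w + exp (F w)) has_field_derivative 2 * deriv F 0) (at 0)"
    using F(2) by (auto intro!: derivative_eq_intros F' F'')
  moreover have "((\<lambda>w. w * deriv F w + exp (F w)) has_field_derivative h) (at 0)"
    by (rule has_field_derivative_transform_within_open [OF H, where S = "ball 0 R"])
      (use assms in auto)
  ultimately have "2 * deriv F 0 = h" by (rule DERIV_unique)
  then show ?thesis by (simp add: field_simps)
qed

lemma exp_eq_imp_eq_on_ball:
  assumes hol: "F holomorphic_on ball 0 \<rho>" "G holomorphic_on ball 0 \<rho>"
    and "F 0 = G 0"
    and eq: "\<And>z. z \<in> ball 0 \<rho> \<Longrightarrow> exp (F z) = exp (G z)"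
    and z: "z \<in> ball 0 \<rho>"
  shows "F z = G z"
proof -
  have "((\<lambda>w. F w - G w) has_field_derivative 0) (at w within ball 0 \<rho>)" if w: "w \<in> ball 0 \<rho>" for w
  proof -
    have F': "(F has_field_derivative deriv F w) (at w)" and G': "(G has_field_derivative deriv G w) (at w)"
      using w by (auto intro!: holomorphic_derivI hol)
    have "((\<lambda>w. exp (F w)) has_field_derivative exp (F w) * deriv F w) (at w)"
      by (auto intro!: derivative_eq_intros F')
    then have "((\<lambda>w. exp (G w)) has_field_derivative exp (F w) * deriv F w) (at w)"
      by (rule has_field_derivative_transform_within_open [where S = "ball 0 \<rho>"]) (use w eq in auto)
    moreover have "((\<lambda>w. exp (G w)) has_field_derivative exp (G w) * deriv G w) (at w)"
      by (auto intro!: derivative_eq_intros G')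
    ultimately have "exp (F w) * deriv F w = exp (G w) * deriv G w" by (rule DERIV_unique)
    then have "deriv F w = deriv G w" using eq [OF w] by simp
    then show ?thesis
      using DERIV_diff [OF F' G'] by (simp add: has_field_derivative_at_within)
  qed
  then obtain C where C: "\<And>w. w \<in> ball 0 \<rho> \<Longrightarrow> F w - G w = C"
    using has_field_derivative_zero_constant [of "ball 0 \<rho>" "\<lambda>w. F w - G w"] by auto
  have "0 < \<rho>" using z by (auto intro: le_less_trans [OF norm_ge_zero])
  then show ?thesis using C [of 0] C [OF z] \<open>F 0 = G 0\<close> by simp
qed

lemma open_superset_cball_larger_ball:
  fixes U :: "complex set"
  assumes "0 \<le> \<rho>" "open U" "cball 0 \<rho> \<subseteq> U"
  obtains \<rho>' where "\<rho> < \<rho>'" "ball 0 \<rho>' \<subseteq> U"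
proof -
  obtain e where e: "e > 0" "(\<Union>x\<in>cball 0 \<rho>. ball x e) \<subseteq> U"
    using compact_subset_open_imp_ball_epsilon_subset [OF compact_cball assms(2,3)] .
  have "z \<in> U" if z: "norm z < \<rho> + e" for z
  proof (cases "norm z \<le> \<rho>")
    case True
    then show ?thesis using assms(3) by auto
  next
    case False
    then have nz: "norm z > 0" using assms(1) by linarith
    define x where "x = of_real (\<rho> / norm z) * z"
    have nx: "norm x = \<rho>"
      using nz assms(1) by (simp add: x_def norm_mult norm_divide)
    have "x - z = of_real (\<rho> / norm z - 1) * z"
      by (simp add: x_def algebra_simps)
    then have "norm (x - z) = \<bar>\<rho> / norm z - 1\<bar> * norm z"
      by (simp only: norm_mult norm_of_real)
    also have "\<dots> = norm z - \<rho>"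
      using nz False by (simp add: abs_if field_simps)
    finally have "z \<in> ball x e" using z by (simp add: dist_norm)
    moreover have "x \<in> cball 0 \<rho>" using nx by simp
    ultimately show ?thesis using e(2) by blast
  qed
  then show ?thesis using e(1) by (intro that [of "\<rho> + e"]) auto
qed

section \<open>Dominants of the Briot-Bouquet equation\<close>

text \<open>
  The hypotheses on \<open>F\<close> say that \<open>q = exp F\<close> solves \<open>q + z q' / q = H\<close> with \<open>H\<close> the half-plane
  map, and that \<open>q\<close> is subordinate to \<open>H\<close> in a form that is strict away from the origin.
\<close>

locale halfplane_dominant =
  fixes R :: real and a :: complex and F :: "complex \<Rightarrow> complex"
  assumes R: "0 < R" "R \<le> 1" and a: "a \<noteq> 0"
    and F: "F holomorphic_on ball 0 R" "F 0 = 0"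
    and ode: "\<And>w. w \<in> ball 0 R \<Longrightarrow> w * deriv F w + exp (F w) = halfplane_map a w"
    and sub: "\<And>w. w \<in> ball 0 R \<Longrightarrow> w \<noteq> 0 \<Longrightarrow> \<exists>v. norm v < norm w \<and> exp (F w) = halfplane_map a v"
begin

text \<open>
  From \<open>w F' w = H w - q w\<close> and \<open>q w = H v\<close> with \<open>norm v < norm w\<close>, the quotient \<open>F' / H'\<close> is
  the one in the supporting half-plane estimate: the convexity of the image of \<open>H\<close> makes \<open>F\<close>
  close-to-convex.
\<close>

lemma inj: "inj_on F (ball 0 R)"
proof (rule inj_on_of_close_to_convex [OF R a F(1)])
  fix w :: complex assume w: "w \<in> ball 0 R"
  show "Re (deriv F w * (1 - w)\<^sup>2 / a) > 0"
  proof (cases "w = 0")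
    case True
    have "(halfplane_map a has_field_derivative a) (at 0)"
      using halfplane_map_has_field_derivative [of 0 a] by simp
    then have "deriv F 0 = a / 2"
      using log_ode_deriv_0 [OF R(1) F] ode by blast
    then have half: "deriv F w * (1 - w)\<^sup>2 / a = 1 / 2" using True a by simp
    show ?thesis unfolding half by simp
  next
    case False
    then obtain v where v: "norm v < norm w" "exp (F w) = halfplane_map a v"
      using sub [OF w] by blast
    have nz: "1 - w \<noteq> 0" "1 - v \<noteq> 0" using v w R by auto
    have "w * deriv F w = halfplane_map a w - halfplane_map a v"
      using ode [OF w] v by (simp add: algebra_simps)
    also have "\<dots> = a * (w - v) / ((1 - w) * (1 - v))"
      using nz by (intro halfplane_map_diff) auto
    finally have "deriv F w = a * (w - v) / ((1 - w) * (1 - v)) / w"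
      using False by (metis nonzero_mult_div_cancel_left)
    then have "deriv F w * (1 - w)\<^sup>2 / a = (w - v) * (1 - w) / (w * (1 - v))"
      using nz False a by (simp add: power2_eq_square)
    then show ?thesis
      using halfplane_support [of v w] v w R by auto
  qed
qed

text \<open>
  At a point \<open>z0\<close> where \<open>norm \<omega>\<close> is maximal on its circle, Jack's lemma turns the left-hand side
  of the equation into \<open>q w + m (H w - q w)\<close> with \<open>m \<ge> 1\<close> and \<open>w = \<omega> z0\<close>; the equation places it in the
  image under \<open>H\<close> of the closed disc of radius \<open>norm z0\<close>.  If \<open>norm w > norm z0\<close>, this is impossible: \<open>H w + (m - 1) (H w - q w)\<close> lies on
  the far side of the supporting line at \<open>H w\<close> of the convex image of the disc of radius \<open>norm w\<close>.
\<close>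

lemma norm_le_of_ode:
  assumes \<omega>: "\<omega> holomorphic_on ball 0 \<rho>" "\<omega> 0 = 0" "\<And>z. z \<in> ball 0 \<rho> \<Longrightarrow> \<omega> z \<in> ball 0 R"
    and L: "\<And>z. z \<in> ball 0 \<rho> \<Longrightarrow> \<exists>u. norm u \<le> norm z \<and>
      z * deriv (\<lambda>z. F (\<omega> z)) z + exp (F (\<omega> z)) = halfplane_map a u"
    and z: "z \<in> ball 0 \<rho>"
  shows "norm (\<omega> z) \<le> norm z"
proof (rule ccontr)
  assume n: "\<not> norm (\<omega> z) \<le> norm z"
  have sph: "sphere 0 (norm z) \<subseteq> ball 0 \<rho>" using z by auto
  have "continuous_on (sphere 0 (norm z)) (\<lambda>z. norm (\<omega> z))"
    using \<omega>(1) sph by (intro continuous_intros holomorphic_on_imp_continuous_on) (rule holomorphic_on_subset)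
  from continuous_attains_sup [OF compact_sphere _ this] obtain z0
    where z0: "norm z0 = norm z" "\<And>y. norm y = norm z \<Longrightarrow> norm (\<omega> y) \<le> norm (\<omega> z0)"
    by auto
  define w where "w = \<omega> z0"
  have z0\<rho>: "z0 \<in> ball 0 \<rho>" using z z0 by auto
  have wz: "norm z0 < norm w"
    using z0(2) [of z] z0(1) n by (simp add: w_def)
  then have w0: "w \<noteq> 0" by auto
  have wR: "w \<in> ball 0 R" using \<omega>(3) [OF z0\<rho>] by (simp add: w_def)
  obtain m where m: "m \<ge> 1" "z0 * deriv \<omega> z0 = of_real m * w"
    using Jack [OF \<omega>(1,2) z0\<rho>] z0 w0 unfolding w_def by metis
  obtain v where v: "norm v < norm w" "exp (F w) = halfplane_map a v"
    using sub [OF wR w0] by blast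
  obtain u where u: "norm u \<le> norm z0"
      "z0 * deriv (\<lambda>z. F (\<omega> z)) z0 + exp (F w) = halfplane_map a u"
    using L [OF z0\<rho>] unfolding w_def by blast
  have nz: "w \<noteq> 1" "v \<noteq> 1" "u \<noteq> 1" using v wR wz u R by auto
  (* N is the outer normal w H'(w) at H w, and T y is the vector from H y to H w divided by N. *)
  define T where "T y = (w - y) * (1 - w) / (w * (1 - y))" for y
  define N where "N = a * w / (1 - w)\<^sup>2"
  have N0: "N \<noteq> 0" using a w0 nz by (simp add: N_def)
  have HT: "halfplane_map a w - halfplane_map a y = T y * N" if "y \<noteq> 1" for y
    unfolding halfplane_map_diff [OF nz(1) that] T_def N_def
    using that nz w0 by (simp add: divide_simps power2_eq_square)
  have "deriv (\<lambda>z. F (\<omega> z)) z0 = deriv F w * deriv \<omega> z0"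
    unfolding w_def using wR z0\<rho>
    by (intro DERIV_imp_deriv DERIV_chain2 holomorphic_derivI [OF F(1)] holomorphic_derivI [OF \<omega>(1)])
      (auto simp: w_def)
  then have "z0 * deriv (\<lambda>z. F (\<omega> z)) z0 = of_real m * (w * deriv F w)"
    using m(2) by (simp add: mult_ac)
  also have "w * deriv F w = T v * N"
    using ode [OF wR] v(2) HT [OF nz(2)] by (simp add: algebra_simps)
  finally have "of_real m * (T v * N) = halfplane_map a u - halfplane_map a v"
    using u(2) v(2) by (simp add: algebra_simps)
  also have "\<dots> = T v * N - T u * N"
    using HT [OF nz(2)] HT [OF nz(3)] by (simp add: algebra_simps)
  finally have "(of_real (m - 1) * T v + T u) * N = 0"
    by (simp add: algebra_simps)
  then have "of_real (m - 1) * T v + T u = 0"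
    using N0 by simp
  then have "Re (of_real (m - 1) * T v + T u) = 0" by simp
  then have "(m - 1) * Re (T v) + Re (T u) = 0"
    by (simp del: of_real_diff)
  moreover have "Re (T v) > 0" "Re (T u) > 0"
    unfolding T_def using v(1) u(1) wz wR R by (auto intro!: halfplane_support)
  ultimately show False
    using m(1) by (smt (verit) mult_nonneg_nonneg)
qed

end

text \<open>
  With \<open>m z = f z / z\<close>, the function \<open>f' / m\<close> is \<open>z f' / f\<close>, and \<open>L\<close> is its logarithm.  The set of
  radii \<open>\<rho>\<close> up to which \<open>m\<close> has no zero and \<open>L\<close> stays in the image of \<open>F\<close> is closed under
  suprema.  It is also open: on \<open>ball 0 \<rho>\<close> the function \<open>\<omega> = F\<inverse> \<circ> L\<close> satisfies \<open>norm (\<omega> z) \<le> norm z\<close>,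
  so the values of \<open>L\<close> there remain in the compact set \<open>F ` cball 0 \<rho>\<close>; this keeps \<open>m\<close> away from
  \<open>0\<close> and \<open>L\<close> away from the boundary of the image of \<open>F\<close>.
\<close>

lemma (in halfplane_dominant) dominates_star_quot:
  assumes f: "f holomorphic_on unit_disc" "deriv f 0 = 1" "\<And>z. z \<in> unit_disc \<Longrightarrow> deriv f z \<noteq> 0"
    and m: "m holomorphic_on unit_disc" "m 0 = 1" "\<And>z. z \<in> unit_disc \<Longrightarrow> f z = z * m z"
    and conv: "\<And>z. z \<in> unit_disc \<Longrightarrow> \<exists>u. norm u \<le> norm z \<and> conv_quot f z = halfplane_map a u"
  obtains \<omega> where "\<omega> holomorphic_on ball 0 R" "\<omega> 0 = 0"
    "\<And>z. z \<in> ball 0 R \<Longrightarrow> norm (\<omega> z) \<le> norm z"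
    "\<And>z. z \<in> ball 0 R \<Longrightarrow> m z \<noteq> 0"
    "\<And>z. z \<in> ball 0 R \<Longrightarrow> deriv f z / m z = exp (F (\<omega> z))"
proof -
  let ?B = "ball (0::complex) R"
  define is_log where "is_log \<rho> L \<longleftrightarrow> L holomorphic_on ball 0 \<rho> \<and> L 0 = 0 \<and>
      (\<forall>z\<in>ball 0 \<rho>. exp (L z) * m z = deriv f z)" for \<rho> L
  define good where "good \<rho> \<longleftrightarrow> (\<exists>L. is_log \<rho> L \<and> L ` ball 0 \<rho> \<subseteq> F ` ?B)" for \<rho>
  have f': "deriv f holomorphic_on unit_disc" by (intro holomorphic_deriv f) auto
  have sub1: "z \<in> unit_disc" if "z \<in> ball 0 \<rho>" "\<rho> \<le> R" for z \<rho>
    using that R by auto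
  have m_nz: "m z \<noteq> 0" if "is_log \<rho> L" "\<rho> \<le> R" "z \<in> ball 0 \<rho>" for z \<rho> L
    using that f(3) [OF sub1 [OF that(3,2)]] unfolding is_log_def by force
  have log_unique: "L z = L' z" if "is_log \<rho> L" "is_log \<rho>' L'" "\<rho> \<le> \<rho>'" "\<rho>' \<le> R" "z \<in> ball 0 \<rho>"
    for \<rho> \<rho>' L L' z
  proof (rule exp_eq_imp_eq_on_ball [where \<rho> = \<rho> and F = L and G = L' and z = z])
    show "L holomorphic_on ball 0 \<rho>" "L' holomorphic_on ball 0 \<rho>" "L 0 = L' 0"
      using that by (auto simp: is_log_def intro: holomorphic_on_subset)
    fix z :: complex assume z: "z \<in> ball 0 \<rho>"
    have "exp (L z) * m z = exp (L' z) * m z"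
      using that z by (auto simp: is_log_def)
    then show "exp (L z) = exp (L' z)"
      using m_nz [OF that(1) _ z] that by simp
  qed fact
  have log_exists: "\<exists>L. is_log \<rho> L"
    if \<rho>: "0 < \<rho>" "\<rho> \<le> R" and nz: "\<And>z. z \<in> ball 0 \<rho> \<Longrightarrow> m z \<noteq> 0" for \<rho>
  proof -
    have "\<rho> \<le> 1" using \<rho> R(2) by simp
    then show ?thesis
      unfolding is_log_def using \<rho>(1) by (intro normalised_log_exists f m nz)
  qed
  obtain g where g: "g holomorphic_on F ` ?B" "\<And>w. w \<in> ?B \<Longrightarrow> g (F w) = w"
    using holomorphic_has_inverse [OF F(1) open_ball inj] by metis
  have openF: "open (F ` ?B)"
    by (intro open_mapping_thm3 [OF F(1) open_ball inj])
  have \<omega>: "(\<lambda>z. g (L z)) holomorphic_on ball 0 \<rho>" "g (L 0) = 0"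
      "\<And>z. z \<in> ball 0 \<rho> \<Longrightarrow> F (g (L z)) = L z" "\<And>z. z \<in> ball 0 \<rho> \<Longrightarrow> norm (g (L z)) \<le> norm z"
    if L: "is_log \<rho> L" "L ` ball 0 \<rho> \<subseteq> F ` ?B" and \<rho>: "\<rho> \<le> R" for \<rho> L
  proof -
    have Lh: "L holomorphic_on ball 0 \<rho>" and L0: "L 0 = 0"
      and Le: "\<And>z. z \<in> ball 0 \<rho> \<Longrightarrow> exp (L z) * m z = deriv f z"
      using L by (auto simp: is_log_def)
    show hol: "(\<lambda>z. g (L z)) holomorphic_on ball 0 \<rho>"
      using holomorphic_on_compose_gen [OF Lh g(1) L(2)] by (simp add: comp_def)
    show 0: "g (L 0) = 0"
      using g(2) [of 0] F(2) R L0 by simp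
    have *: "g (L z) \<in> ?B \<and> F (g (L z)) = L z" if "z \<in> ball 0 \<rho>" for z
    proof -
      have "L z \<in> F ` ?B" using L(2) imageI [OF that] by (rule subsetD)
      then obtain w where "w \<in> ?B" "L z = F w" by blast
      then show ?thesis using g(2) by simp
    qed
    then show "\<And>z. z \<in> ball 0 \<rho> \<Longrightarrow> F (g (L z)) = L z" by blast
    show "norm (g (L z)) \<le> norm z" if "z \<in> ball 0 \<rho>" for z
    proof (rule norm_le_of_ode [OF hol 0 _ _ that])
      fix z :: complex assume z: "z \<in> ball 0 \<rho>"
      show "g (L z) \<in> ?B" using * z by blast
      have "deriv (\<lambda>z. F (g (L z))) z = deriv L z"
        by (rule complex_derivative_transform_within_open [where s = "ball 0 \<rho>"])
          (use * z Lh in \<open>auto intro!: holomorphic_transform [OF Lh]\<close>)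
      moreover have "z * deriv L z + exp (L z) = conv_quot f z"
        using \<rho> R by (intro log_star_quot_ode [OF f(1,3) m(1,3) _ Lh Le z]) auto
      moreover obtain u where "norm u \<le> norm z" "conv_quot f z = halfplane_map a u"
        using conv [OF sub1 [OF z \<rho>]] by blast
      ultimately show "\<exists>u. norm u \<le> norm z \<and>
          z * deriv (\<lambda>z. F (g (L z))) z + exp (F (g (L z))) = halfplane_map a u"
        using * [OF z] by auto
    qed
  qed
  have extend: "\<exists>\<rho>'. \<rho> < \<rho>' \<and> \<rho>' \<le> R \<and> good \<rho>'" if \<rho>: "0 \<le> \<rho>" "\<rho> < R" "good \<rho>" for \<rho>
  proof -
    obtain L where L: "is_log \<rho> L" "L ` ball 0 \<rho> \<subseteq> F ` ?B"
      using \<rho>(3) by (auto simp: good_def)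
    have cb: "cball (0::complex) \<rho> \<subseteq> ?B" "cball (0::complex) \<rho> \<subseteq> unit_disc"
      using \<rho> R by auto
    let ?K = "F ` cball 0 \<rho>"
    have K: "compact ?K"
      by (intro compact_continuous_image holomorphic_on_imp_continuous_on
        holomorphic_on_subset [OF F(1)] cb) auto
    have LK: "L z \<in> ?K" if "z \<in> ball 0 \<rho>" for z
    proof -
      have "norm (g (L z)) \<le> \<rho>"
        using \<omega>(4) [OF L _ that] \<rho> that by auto
      then show ?thesis
        using \<omega>(3) [OF L _ that] \<rho> by (intro image_eqI [where x = "g (L z)"]) auto
    qed
    have "m z \<noteq> 0" if z: "z \<in> cball 0 \<rho>" for z
    proof (cases "\<rho> = 0")
      case True
      then show ?thesis using z m(2) by simp
    next
      case False
      have "compact (exp ` ?K)"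
        by (intro compact_continuous_image K continuous_intros)
      then obtain M where M: "\<And>y. y \<in> ?K \<Longrightarrow> norm (exp y) \<le> M"
        using compact_imp_bounded bounded_iff by (metis imageI)
      have "norm (deriv f y) - M * norm (m y) \<le> 0" if "y \<in> ball 0 \<rho>" for y
      proof -
        have "norm (deriv f y) = norm (exp (L y)) * norm (m y)"
          using L(1) that unfolding is_log_def by (metis norm_mult)
        also have "\<dots> \<le> M * norm (m y)"
          by (intro mult_right_mono M LK that) auto
        finally show ?thesis by simp
      qed
      then have "(\<lambda>y. norm (deriv f y) - M * norm (m y)) ` closure (ball 0 \<rho>) \<subseteq> {..0}"
        using False \<rho> cb
        by (intro image_closure_subset continuous_intros holomorphic_on_imp_continuous_on
          holomorphic_on_subset [OF f'] holomorphic_on_subset [OF m(1)]) auto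
      moreover have "z \<in> closure (ball 0 \<rho>)" using z False \<rho> by simp
      ultimately have "norm (deriv f z) - M * norm (m z) \<le> 0" by blast
      moreover have "deriv f z \<noteq> 0" using f(3) cb z by blast
      ultimately show ?thesis by auto
    qed
    moreover have "open {z \<in> ?B. m z \<noteq> 0}"
    proof -
      have "open (?B \<inter> m -` (- {0}))"
        using sub1 by (intro continuous_open_preimage holomorphic_on_imp_continuous_on
          holomorphic_on_subset [OF m(1)]) auto
      moreover have "?B \<inter> m -` (- {0}) = {z \<in> ?B. m z \<noteq> 0}" by auto
      ultimately show ?thesis by simp
    qed
    ultimately obtain \<rho>1 where \<rho>1: "\<rho> < \<rho>1" "ball 0 \<rho>1 \<subseteq> {z \<in> ?B. m z \<noteq> 0}"
      using open_superset_cball_larger_ball [OF \<rho>(1), of "{z \<in> ?B. m z \<noteq> 0}"] cb by blast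
    have "ball 0 \<rho>1 \<subseteq> ?B" using \<rho>1(2) by blast
    then have \<rho>1R: "\<rho>1 \<le> R"
      using \<rho>1(1) \<rho>(1) by (simp add: ball_subset_ball_iff)
    have "0 < \<rho>1" "\<And>z. z \<in> ball 0 \<rho>1 \<Longrightarrow> m z \<noteq> 0" using \<rho>1 \<rho>(1) by auto
    then obtain L1 where L1: "is_log \<rho>1 L1"
      using log_exists [OF _ \<rho>1R] by blast
    have L1h: "continuous_on (ball 0 \<rho>1) L1"
      using L1 by (auto simp: is_log_def intro: holomorphic_on_imp_continuous_on)
    have L1K: "L1 z \<in> ?K" if z: "z \<in> cball 0 \<rho>" for z
    proof (cases "\<rho> = 0")
      case True
      then show ?thesis using z L1 F(2) by (auto simp: is_log_def)
    next
      case False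
      have "L1 ` closure (ball 0 \<rho>) \<subseteq> ?K"
      proof (rule image_closure_subset)
        show "continuous_on (closure (ball 0 \<rho>)) L1"
          using False \<rho> \<rho>1 by (intro continuous_on_subset [OF L1h]) auto
        show "closed ?K" using K by (rule compact_imp_closed)
        show "L1 ` ball 0 \<rho> \<subseteq> ?K"
          using log_unique [OF L(1) L1 _ \<rho>1R] \<rho>1 LK by auto
      qed
      then show ?thesis using z False \<rho> by auto
    qed
    have "open (ball 0 \<rho>1 \<inter> L1 -` (F ` ?B))"
      by (intro continuous_open_preimage L1h openF) auto
    moreover have "cball 0 \<rho> \<subseteq> ball 0 \<rho>1 \<inter> L1 -` (F ` ?B)"
      using L1K cb \<rho>1 by fastforce
    ultimately obtain \<rho>2 where \<rho>2: "\<rho> < \<rho>2" "ball 0 \<rho>2 \<subseteq> ball 0 \<rho>1 \<inter> L1 -` (F ` ?B)"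
      using open_superset_cball_larger_ball [OF \<rho>(1)] by metis
    have "ball 0 \<rho>2 \<subseteq> ball (0::complex) \<rho>1" using \<rho>2(2) by blast
    then have "\<rho>2 \<le> \<rho>1" using \<rho>2(1) \<rho>(1) by (simp add: ball_subset_ball_iff)
    then have "good \<rho>2"
      unfolding good_def using L1 \<rho>2
      by (intro exI [of _ L1]) (auto simp: is_log_def intro: holomorphic_on_subset)
    then show ?thesis using \<rho>2 \<open>\<rho>2 \<le> \<rho>1\<close> \<rho>1R by (intro exI [of _ \<rho>2]) auto
  qed
  define S where "S = {\<rho>. 0 \<le> \<rho> \<and> \<rho> \<le> R \<and> good \<rho>}"
  have "good 0"
    unfolding good_def is_log_def by (intro exI [of _ "\<lambda>_. 0"]) auto
  then have S0: "0 \<in> S" using R by (auto simp: S_def)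
  have bdd: "bdd_above S" by (auto simp: S_def intro!: bdd_aboveI [of _ R])
  define \<sigma> where "\<sigma> = Sup S"
  have \<sigma>: "0 \<le> \<sigma>" "\<sigma> \<le> R"
    unfolding \<sigma>_def using S0 bdd by (auto intro: cSup_upper cSup_least simp: S_def)
  have cover: "\<exists>\<rho>\<in>S. z \<in> ball 0 \<rho>" if "z \<in> ball 0 \<sigma>" for z :: complex
  proof -
    have "norm z < Sup S" using that by (simp add: \<sigma>_def)
    then show ?thesis using less_cSup_iff [OF _ bdd] S0 by auto
  qed
  have "good \<sigma>"
  proof (cases "\<sigma> = 0")
    case True
    then show ?thesis using \<open>good 0\<close> by simp
  next
    case False
    have "m z \<noteq> 0" if "z \<in> ball 0 \<sigma>" for z
      using cover [OF that] m_nz by (auto simp: S_def good_def)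
    then obtain L where L: "is_log \<sigma> L"
      using log_exists [of \<sigma>] \<sigma> False by auto
    have "L z \<in> F ` ?B" if z: "z \<in> ball 0 \<sigma>" for z
    proof -
      obtain \<rho> where \<rho>: "\<rho> \<in> S" "z \<in> ball 0 \<rho>" using cover [OF z] by blast
      then obtain L' where L': "is_log \<rho> L'" "L' ` ball 0 \<rho> \<subseteq> F ` ?B"
        by (auto simp: S_def good_def)
      have "\<rho> \<le> \<sigma>" unfolding \<sigma>_def using \<rho> bdd by (intro cSup_upper)
      then have "L' z = L z"
        using log_unique [OF L'(1) L _ \<sigma>(2) \<rho>(2)] by simp
      then show ?thesis using L'(2) \<rho>(2) by (metis image_subset_iff)
    qed
    then show ?thesis using L by (auto simp: good_def)
  qed
  have "\<sigma> = R"
  proof (rule ccontr)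
    assume "\<sigma> \<noteq> R"
    then obtain \<rho>' where \<rho>': "\<sigma> < \<rho>'" "\<rho>' \<le> R" "good \<rho>'"
      using extend [OF \<sigma>(1) _ \<open>good \<sigma>\<close>] \<sigma>(2) by auto
    then have "\<rho>' \<in> S" using \<sigma>(1) by (simp add: S_def)
    then have "\<rho>' \<le> \<sigma>"
      unfolding \<sigma>_def using bdd by (intro cSup_upper)
    then show False using \<rho>'(1) by simp
  qed
  then obtain L where L: "is_log R L" "L ` ball 0 R \<subseteq> F ` ?B"
    using \<open>good \<sigma>\<close> by (auto simp: good_def)
  show ?thesis
  proof (rule that [of "\<lambda>z. g (L z)"])
    show "(\<lambda>z. g (L z)) holomorphic_on ball 0 R" "g (L 0) = 0"
      "\<And>z. z \<in> ball 0 R \<Longrightarrow> norm (g (L z)) \<le> norm z"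
      using \<omega> [OF L] by auto
    show nz: "\<And>z. z \<in> ball 0 R \<Longrightarrow> m z \<noteq> 0"
      using m_nz [OF L(1)] by auto
    show "deriv f z / m z = exp (F (g (L z)))" if "z \<in> ball 0 R" for z
    proof -
      have "exp (L z) * m z = deriv f z" using L(1) that by (simp add: is_log_def)
      then show ?thesis
        using \<omega>(3) [OF L order_refl that] nz [OF that] by (simp add: field_simps)
    qed
  qed
qed

section \<open>Robertson functions and the extremal function\<close>

text \<open>
  The value \<open>1 - a\<close>, that of \<open>H\<close> at infinity, is the only one that \<open>H\<close> does not take in the plane.
\<close>

lemma halfplane_map_inverse:
  assumes "a \<noteq> 0" "w - 1 + a \<noteq> 0"
  shows "halfplane_map a ((w - 1) / (w - 1 + a)) = w"
proof -
  have "1 - (w - 1) / (w - 1 + a) = a / (w - 1 + a)"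
    using assms by (simp add: field_simps)
  then show ?thesis
    using assms by (simp add: halfplane_map_def)
qed

text \<open>
  The half-plane consists of the points that are closer to \<open>1\<close> than to \<open>- c\<close>, its mirror image in the
  boundary line.
\<close>

lemma norm_diff_1_less:
  assumes "norm c = 1" "Re (w * cnj (1 + c)) > 0"
  shows "norm (w - 1) < norm (w + c)"
proof -
  have "(Re c)\<^sup>2 + (Im c)\<^sup>2 = 1"
    using assms(1) by (simp flip: cmod_power2)
  then have "(norm (w + c))\<^sup>2 - (norm (w - 1))\<^sup>2 = 2 * Re (w * cnj (1 + c))"
    by (simp add: cmod_power2) (simp add: power2_eq_square algebra_simps)
  then have "(norm (w - 1))\<^sup>2 < (norm (w + c))\<^sup>2"
    using assms(2) by linarith
  then show ?thesis
    by (rule power_less_imp_less_base) simp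
qed

lemma one_plus_exp:
  "1 + exp (2 * \<i> * of_real l) = 2 * exp (\<i> * of_real l) * of_real (cos l)"
  using exp_cos_eq [of l] by (simp add: algebra_simps)

lemma P_rob_halfplane_map:
  assumes "z \<in> unit_disc"
  shows "P_rob l z = halfplane_map (1 + exp (2 * \<i> * of_real l)) z"
proof -
  have "1 - z \<noteq> 0" using assms by auto
  then show ?thesis
    unfolding P_rob_eq [OF assms] halfplane_map_def by (simp add: field_simps)
qed

text \<open>
  The function \<open>conv_quot f\<close> maps the disc into the half-plane \<open>H ` unit_disc\<close> and takes the value \<open>1\<close>
  at \<open>0\<close>, so the Schwarz lemma applies to \<open>H\<inverse> \<circ> conv_quot f\<close>.
\<close>

lemma robertson_conv_quot:
  assumes f: "f \<in> robertson l" and l: "cos l > 0" and z: "z \<in> unit_disc"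
  shows "\<exists>u. norm u \<le> norm z \<and> conv_quot f z = halfplane_map (1 + exp (2 * \<i> * of_real l)) u"
proof -
  define c :: complex where "c = exp (2 * \<i> * of_real l)"
  define \<phi> where "\<phi> w = (conv_quot f w - 1) / (conv_quot f w - 1 + (1 + c))" for w
  have c: "norm c = 1" "1 + c = 2 * exp (\<i> * of_real l) * of_real (cos l)"
    using one_plus_exp [of l] by (auto simp: c_def)
  have a0: "1 + c \<noteq> 0" using c(2) l by simp
  have less: "norm (conv_quot f w - 1) < norm (conv_quot f w - 1 + (1 + c))" if "w \<in> unit_disc" for w
  proof -
    have "Re (exp (- \<i> * of_real l) * conv_quot f w) > 0"
      using f that by (auto simp: robertson_def)
    moreover have "conv_quot f w * cnj (1 + c)
        = of_real (2 * cos l) * (exp (- \<i> * of_real l) * conv_quot f w)"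
      unfolding c(2) by (simp add: exp_cnj)
    ultimately have "Re (conv_quot f w * cnj (1 + c)) > 0"
      using l by (simp only: Re_complex_of_real times_complex.sel Im_complex_of_real) simp
    from norm_diff_1_less [OF c(1) this] show ?thesis by simp
  qed
  have "\<phi> holomorphic_on ball 0 1"
    unfolding \<phi>_def [abs_def] using f less
    by (intro holomorphic_intros) (fastforce simp: robertson_def)+
  moreover have "\<phi> 0 = 0" by (simp add: \<phi>_def conv_quot_def)
  moreover have "norm (\<phi> w) < 1" if "norm w < 1" for w
    using less [of w] that by (auto simp: \<phi>_def norm_divide divide_less_eq)
  ultimately have "norm (\<phi> z) \<le> norm z"
    using z by (intro Schwarz_Lemma(1)) auto
  moreover have "conv_quot f z - 1 + (1 + c) \<noteq> 0" using less [OF z] by force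
  then have "halfplane_map (1 + c) (\<phi> z) = conv_quot f z"
    unfolding \<phi>_def using a0 by (intro halfplane_map_inverse)
  ultimately show ?thesis unfolding c_def by metis
qed

lemma f_rob_normalised:
  "f_rob l holomorphic_on unit_disc" "f_rob l 0 = 0" "deriv (f_rob l) 0 = 1"
  "z \<in> unit_disc \<Longrightarrow> deriv (f_rob l) z \<noteq> 0"
proof -
  show "f_rob l holomorphic_on unit_disc"
    unfolding f_rob_eq [abs_def] using one_minus_notin_nonpos
    by (auto intro!: holomorphic_intros)
  show "f_rob l 0 = 0" by (simp add: f_rob_eq)
  show "deriv (f_rob l) 0 = 1" using deriv_f_rob [of 0 l] by simp
  show "z \<in> unit_disc \<Longrightarrow> deriv (f_rob l) z \<noteq> 0"
    by (subst deriv_f_rob) auto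
qed

lemma holomorphic_dilation:
  assumes "0 < r" "h holomorphic_on ball 0 r"
  shows "(\<lambda>z. h (of_real r * z)) holomorphic_on unit_disc"
proof -
  have "(\<lambda>z::complex. of_real r * z) ` unit_disc \<subseteq> ball 0 r"
    using assms(1) by (auto simp: norm_mult)
  then have "h \<circ> (\<lambda>z. of_real r * z) holomorphic_on unit_disc"
    by (intro holomorphic_on_compose_gen [OF _ assms(2)] holomorphic_intros)
  then show ?thesis by (simp add: comp_def)
qed

text \<open>
  Subordination to a function with a larger derivative at \<open>0\<close> is never realised by a rotation,
  so the Schwarz lemma is strict.
\<close>

lemma subordinate_strict:
  assumes sub: "subordinate (\<lambda>z. g (of_real r * z)) (\<lambda>z. G (of_real r * z))" and "0 < r"
    and g': "(g has_field_derivative g') (at 0)" and G': "(G has_field_derivative G') (at 0)"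
    and less: "norm g' < norm G'"
    and w: "w \<in> ball 0 r" "w \<noteq> 0"
  shows "\<exists>v. norm v < norm w \<and> g w = G v"
proof -
  obtain \<omega> where \<omega>: "\<omega> holomorphic_on ball 0 1" "\<omega> 0 = 0"
    "\<And>z. norm z < 1 \<Longrightarrow> norm (\<omega> z) < 1"
    "\<And>z. norm z < 1 \<Longrightarrow> g (of_real r * z) = G (of_real r * \<omega> z)"
    using sub by (auto simp: subordinate_def)
  have scale: "norm (z / of_real r) < 1" "of_real r * (z / of_real r) = z" if "z \<in> ball 0 r" for z :: complex
    using that \<open>0 < r\<close> by (auto simp: norm_divide)
  define \<zeta> where "\<zeta> = w / of_real r"
  have \<zeta>: "norm \<zeta> < 1" "\<zeta> \<noteq> 0" "of_real r * \<zeta> = w"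
    using scale [OF w(1)] w(2) \<open>0 < r\<close> by (auto simp: \<zeta>_def)
  have "norm (\<omega> \<zeta>) < norm \<zeta>"
  proof (rule ccontr)
    assume "\<not> norm (\<omega> \<zeta>) < norm \<zeta>"
    with Schwarz_Lemma(1) [OF \<omega>(1-3) \<zeta>(1)] have "norm (\<omega> \<zeta>) = norm \<zeta>" by simp
    with Schwarz_Lemma(3) [OF \<omega>(1-3) \<zeta>(1)] \<zeta> obtain \<alpha>
      where \<alpha>: "\<And>z. norm z < 1 \<Longrightarrow> \<omega> z = \<alpha> * z" "norm \<alpha> = 1" by blast
    have "((\<lambda>z. G (\<alpha> * z)) has_field_derivative G' * \<alpha>) (at 0)"
      by (rule DERIV_chain2 [where f = G and g = "\<lambda>z. \<alpha> * z"])
        (use G' in \<open>auto intro!: derivative_eq_intros\<close>)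
    then have "(g has_field_derivative G' * \<alpha>) (at 0)"
    proof (rule has_field_derivative_transform_within_open [where S = "ball 0 r"])
      fix z :: complex assume z: "z \<in> ball 0 r"
      have "of_real r * (\<alpha> * (z / of_real r)) = \<alpha> * z"
        using \<open>0 < r\<close> by simp
      then show "G (\<alpha> * z) = g z"
        using \<omega>(4) [OF scale(1) [OF z]] \<alpha>(1) [OF scale(1) [OF z]] scale(2) [OF z] by simp
    qed (use \<open>0 < r\<close> in auto)
    then have "g' = G' * \<alpha>" using g' by (rule DERIV_unique [THEN sym])
    then show False using less \<alpha>(2) by (simp add: norm_mult)
  qed
  then have "norm (of_real r * \<omega> \<zeta>) < norm (of_real r * \<zeta>)"
    using \<open>0 < r\<close> by (simp add: norm_mult)
  then show ?thesis
    using \<omega>(4) [OF \<zeta>(1)] \<zeta>(3) by auto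
qed

lemma Q_rob_near_0:
  obtains \<delta> where "0 < \<delta>" "\<delta> \<le> 1" "Q_rob l holomorphic_on ball 0 \<delta>"
    "(Q_rob l has_field_derivative (1 + exp (2 * \<i> * of_real l)) / 2) (at 0)"
proof -
  define c :: complex where "c = exp (2 * \<i> * of_real l)"
  note k = f_rob_normalised [where l = l]
  obtain m where m: "m holomorphic_on unit_disc" "m 0 = 1"
    "\<And>z. z \<in> unit_disc \<Longrightarrow> f_rob l z = z * m z"
    "\<And>z. z \<in> unit_disc \<Longrightarrow> Q_rob l z = deriv (f_rob l) z / m z"
    using star_quot_factor [OF k(1-3)] unfolding Q_rob_def by metis
  have "open (unit_disc \<inter> m -` (- {0}))"
    by (intro continuous_open_preimage holomorphic_on_imp_continuous_on m) auto
  then obtain \<delta> where \<delta>: "0 < \<delta>" "ball 0 \<delta> \<subseteq> unit_disc \<inter> m -` (- {0})"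
    using open_superset_cball_larger_ball [of 0 "unit_disc \<inter> m -` (- {0})"] m(2) by auto
  have "ball 0 \<delta> \<subseteq> unit_disc" using \<delta>(2) by blast
  then have \<delta>1: "\<delta> \<le> 1" using \<delta>(1) by (simp add: ball_subset_ball_iff)
  obtain F where F: "F holomorphic_on ball 0 \<delta>" "F 0 = 0"
    "\<And>z. z \<in> ball 0 \<delta> \<Longrightarrow> exp (F z) * m z = deriv (f_rob l) z"
    using normalised_log_exists [OF \<delta>(1) \<delta>1 k(1,3,4) m(1,2)] \<delta>(2) by blast
  have Q: "exp (F z) = Q_rob l z" if "z \<in> ball 0 \<delta>" for z
  proof -
    have "z \<in> unit_disc" "m z \<noteq> 0" using \<delta>(2) that by auto
    then show ?thesis using F(3) [OF that] m(4) by (metis nonzero_mult_div_cancel_right)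
  qed
  have F': "deriv F 0 = (1 + c) / 2"
  proof (rule log_ode_deriv_0 [OF \<delta>(1) F(1,2)])
    show "(halfplane_map (1 + c) has_field_derivative 1 + c) (at 0)"
      using halfplane_map_has_field_derivative [of 0 "1 + c"] by simp
    fix w :: complex assume w: "w \<in> ball 0 \<delta>"
    then have "w \<in> unit_disc" using \<delta>(2) by blast
    then show "w * deriv F w + exp (F w) = halfplane_map (1 + c) w"
      using log_star_quot_ode [OF k(1,4) m(1,3) \<delta>1 F(1,3) w] P_rob_halfplane_map [of w l]
      by (simp add: P_rob_def c_def)
  qed
  have "((\<lambda>z. exp (F z)) has_field_derivative exp (F 0) * deriv F 0) (at 0)"
    using holomorphic_derivI [OF F(1), of 0] \<delta>(1) by (auto intro!: derivative_eq_intros)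
  then have "((\<lambda>z. exp (F z)) has_field_derivative (1 + c) / 2) (at 0)"
    unfolding F' F(2) by simp
  then have "(Q_rob l has_field_derivative (1 + c) / 2) (at 0)"
    by (rule has_field_derivative_transform_within_open [where S = "ball 0 \<delta>"]) (use Q \<delta> in auto)
  moreover have "(\<lambda>z. exp (F z)) holomorphic_on ball 0 \<delta>"
    by (intro holomorphic_intros F)
  then have "Q_rob l holomorphic_on ball 0 \<delta>"
    by (rule holomorphic_transform) (rule Q)
  ultimately show ?thesis
    using that \<delta>(1) \<delta>1 by (simp add: c_def)
qed

text \<open>
  The function \<open>g = H\<inverse> \<circ> Q_rob l\<close>, where \<open>H = P_rob l\<close>, is defined near \<open>0\<close> and has
  derivative \<open>1 / 2\<close> there, hence it shrinks small discs.
\<close>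

lemma exists_subordination_radius:
  assumes "cos l > 0"
  shows "\<exists>r. 0 < r \<and> r < 1 \<and>
    subordinate (\<lambda>z. Q_rob l (of_real r * z)) (\<lambda>z. P_rob l (of_real r * z))"
proof -
  define a :: complex where "a = 1 + exp (2 * \<i> * of_real l)"
  have a0: "a \<noteq> 0" using assms unfolding a_def one_plus_exp by simp
  obtain \<delta> where \<delta>: "0 < \<delta>" "\<delta> \<le> 1" "Q_rob l holomorphic_on ball 0 \<delta>"
    "(Q_rob l has_field_derivative a / 2) (at 0)"
    using Q_rob_near_0 unfolding a_def by blast
  define g where "g z = (Q_rob l z - 1) / (Q_rob l z - 1 + a)" for z
  have g0: "g 0 = 0" by (simp add: g_def Q_rob_0)
  have "(g has_field_derivative 1 / 2) (at 0)"
    unfolding g_def [abs_def] using a0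
    by (auto intro!: derivative_eq_intros \<delta>(4) simp: Q_rob_0)
  then have "((\<lambda>z. g z / z) \<longlongrightarrow> 1 / 2) (at 0)"
    by (simp add: has_field_derivative_iff g0)
  then have "((\<lambda>z. norm (g z / z)) \<longlongrightarrow> norm (1 / 2 :: complex)) (at 0)"
    by (rule tendsto_norm)
  then have "eventually (\<lambda>z. norm (g z / z) < 1) (at 0)"
    by (rule order_tendstoD) simp
  then obtain d where d: "d > 0" "\<And>z. z \<noteq> 0 \<Longrightarrow> norm z < d \<Longrightarrow> norm (g z / z) < 1"
    unfolding eventually_at by (auto simp: dist_norm)
  have gle: "norm (g z) \<le> norm z" if "norm z < d" for z
    using d(2) [of z] that g0 by (cases "z = 0") (auto simp: norm_divide divide_less_eq)
  let ?U = "ball 0 \<delta> \<inter> (\<lambda>z. Q_rob l z - 1 + a) -` (- {0})"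
  have "open ?U"
    by (intro continuous_open_preimage holomorphic_on_imp_continuous_on holomorphic_intros \<delta>) auto
  then obtain e where e: "0 < e" "ball 0 e \<subseteq> ?U"
    using open_superset_cball_larger_ball [of 0 ?U] a0 \<delta>(1) by (auto simp: Q_rob_0)
  define r where "r = min (1 / 2) (min d e)"
  have r: "0 < r" "r < 1" "r \<le> d" "r \<le> e" using d e by (auto simp: r_def)
  have rz: "of_real r * z \<in> ball 0 r" if "z \<in> unit_disc" for z
    using that r by (simp add: norm_mult)
  have rU: "ball 0 r \<subseteq> ?U" using e r by (force simp: subset_iff)
  have g_hol: "g holomorphic_on ball 0 r"
    unfolding g_def [abs_def] using rU
    by (intro holomorphic_intros holomorphic_on_subset [OF \<delta>(3)]) auto
  note comp = holomorphic_dilation [OF r(1)]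
  have gr: "norm (g (of_real r * z)) < r" "P_rob l (g (of_real r * z)) = Q_rob l (of_real r * z)"
    if "z \<in> unit_disc" for z
  proof -
    have w: "of_real r * z \<in> ball 0 r" using rz [OF that] .
    then show *: "norm (g (of_real r * z)) < r" using gle [of "of_real r * z"] r by auto
    have "Q_rob l (of_real r * z) - 1 + a \<noteq> 0" using rU w by auto
    from halfplane_map_inverse [OF a0 this]
    have "halfplane_map a (g (of_real r * z)) = Q_rob l (of_real r * z)"
      by (simp add: g_def)
    then show "P_rob l (g (of_real r * z)) = Q_rob l (of_real r * z)"
      using P_rob_halfplane_map [of "g (of_real r * z)" l] * r by (simp add: a_def)
  qed
  have "subordinate (\<lambda>z. Q_rob l (of_real r * z)) (\<lambda>z. P_rob l (of_real r * z))"
    unfolding subordinate_def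
  proof (intro conjI exI ballI)
    show "(\<lambda>z. Q_rob l (of_real r * z)) holomorphic_on unit_disc"
      using rU by (intro comp holomorphic_on_subset [OF \<delta>(3)]) auto
    have "P_rob l holomorphic_on unit_disc"
      using halfplane_map_holomorphic by (rule holomorphic_transform) (simp add: P_rob_halfplane_map)
    then show "(\<lambda>z. P_rob l (of_real r * z)) holomorphic_on unit_disc"
      using r by (intro comp) (auto intro: holomorphic_on_subset)
    show "(\<lambda>z. g (of_real r * z) / of_real r) holomorphic_on unit_disc"
      using r by (intro holomorphic_intros comp g_hol) auto
    show "g (of_real r * 0) / of_real r = 0" by (simp add: g0)
    fix z :: complex assume z: "z \<in> unit_disc"
    show "norm (g (of_real r * z) / of_real r) < 1"
      using gr(1) [OF z] r by (simp add: norm_divide)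
    show "Q_rob l (of_real r * z) = P_rob l (of_real r * (g (of_real r * z) / of_real r))"
      using gr(2) [OF z] r by simp
  qed
  then show ?thesis using r by blast
qed

lemma subordinate_radius_holomorphic:
  assumes "subordinate (\<lambda>z. g (of_real r * z)) (\<lambda>z. G (of_real r * z))" "0 < r"
  shows "g holomorphic_on ball 0 r"
proof -
  have "(\<lambda>z. g (of_real r * z)) holomorphic_on unit_disc"
    using assms by (simp add: subordinate_def)
  moreover have "(\<lambda>z. z / of_real r :: complex) ` ball 0 r \<subseteq> unit_disc"
    using assms by (auto simp: norm_divide)
  ultimately have "(\<lambda>z. g (of_real r * z)) \<circ> (\<lambda>z. z / of_real r) holomorphic_on ball 0 r"
    using assms by (intro holomorphic_on_compose_gen [where t = unit_disc]) (auto intro!: holomorphic_intros)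
  then show ?thesis
    by (rule holomorphic_transform) (use assms in auto)
qed

theorem corollary1:
  fixes l :: real and f :: "complex \<Rightarrow> complex"
  assumes "- pi / 2 < l" and "l < pi / 2"
    and "f \<in> robertson l"
  shows "subordinate_in (R1 l) (star_quot f) (star_quot (f_rob l))"
proof -
  have cosl: "cos l > 0" using assms by (intro cos_gt_zero_pi) auto
  define a :: complex where "a = 1 + exp (2 * \<i> * of_real l)"
  have a0: "a \<noteq> 0" using cosl unfolding a_def one_plus_exp by simp
  define S where "S = {r. 0 < r \<and> r < 1 \<and>
    subordinate (\<lambda>z. Q_rob l (of_real r * z)) (\<lambda>z. P_rob l (of_real r * z))}"
  define R where "R = R1 l"
  have R_def': "R = Sup S" by (simp add: R_def R1_def S_def)
  obtain r0 where r0: "r0 \<in> S"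
    using exists_subordination_radius [OF cosl] by (auto simp: S_def)
  have bdd: "bdd_above S" by (auto simp: S_def intro!: bdd_aboveI [of _ 1])
  have "r0 \<le> R" unfolding R_def' using r0 bdd by (rule cSup_upper)
  then have R0: "0 < R" using r0 by (auto simp: S_def)
  have R1: "R \<le> 1" unfolding R_def' using r0 by (intro cSup_least) (auto simp: S_def)
  have cover: "\<exists>r\<in>S. z \<in> ball 0 r" if "z \<in> ball 0 R" for z :: complex
    using that less_cSup_iff [OF _ bdd, of "norm z"] r0 by (auto simp: R_def')

  have Q_hol: "Q_rob l holomorphic_on ball 0 R"
  proof -
    have "Q_rob l holomorphic_on (\<Union>r\<in>S. ball 0 r)"
      by (rule holomorphic_on_UN_open)
        (auto simp: S_def intro: subordinate_radius_holomorphic)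
    then show ?thesis by (rule holomorphic_on_subset) (use cover in blast)
  qed
  note k = f_rob_normalised [where l = l]
  obtain n where n: "n holomorphic_on unit_disc" "n 0 = 1"
    "\<And>z. z \<in> unit_disc \<Longrightarrow> f_rob l z = z * n z"
    "\<And>z. z \<in> unit_disc \<Longrightarrow> Q_rob l z = deriv (f_rob l) z / n z"
    using star_quot_factor [OF k(1-3)] unfolding Q_rob_def by metis
  have RD: "z \<in> unit_disc" if "z \<in> ball 0 R" for z using that R1 by auto
  have n_nz: "n z \<noteq> 0" if z: "z \<in> ball 0 R" for z
  proof -
    have "Q_rob l z * n z = deriv (f_rob l) z"
    proof (rule holomorphic_quotient_mult [where S = "ball 0 R" and w = 0 and q = "Q_rob l"
          and h = n and g = "deriv (f_rob l)"])
      show "deriv (f_rob l) holomorphic_on ball 0 R"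
        using RD by (intro holomorphic_on_subset [OF holomorphic_deriv [OF k(1)]]) auto
      show "n holomorphic_on ball 0 R"
        using RD by (intro holomorphic_on_subset [OF n(1)]) auto
    qed (use Q_hol n z R0 RD in auto)
    then show ?thesis using k(4) [OF RD [OF z]] by auto
  qed
  obtain F where F: "F holomorphic_on ball 0 R" "F 0 = 0"
    "\<And>z. z \<in> ball 0 R \<Longrightarrow> exp (F z) * n z = deriv (f_rob l) z"
    using normalised_log_exists [OF R0 R1 k(1,3,4) n(1,2)] n_nz by blast
  have FQ: "exp (F z) = Q_rob l z" if "z \<in> ball 0 R" for z
    using F(3) [OF that] n(4) [OF RD [OF that]] n_nz [OF that]
    by (metis nonzero_mult_div_cancel_right)

  have Q': "(Q_rob l has_field_derivative a / 2) (at 0)"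
    using Q_rob_near_0 unfolding a_def by blast
  have P': "(P_rob l has_field_derivative a) (at 0)"
    by (rule has_field_derivative_transform_within_open [where S = unit_disc and f = "halfplane_map a"])
      (use halfplane_map_has_field_derivative [of 0 a] in \<open>auto simp: P_rob_halfplane_map a_def\<close>)
  interpret halfplane_dominant R a F
  proof
    fix w :: complex assume w: "w \<in> ball 0 R"
    show "w * deriv F w + exp (F w) = halfplane_map a w"
      using log_star_quot_ode [OF k(1,4) n(1,3) R1 F(1,3) w] P_rob_halfplane_map [OF RD [OF w], of l]
      by (simp add: P_rob_def a_def)
    assume "w \<noteq> 0"
    obtain r where r: "r \<in> S" "w \<in> ball 0 r" using cover [OF w] by blast
    have "\<exists>v. norm v < norm w \<and> Q_rob l w = P_rob l v"
      by (rule subordinate_strict [OF _ _ Q' P']) (use r a0 \<open>w \<noteq> 0\<close> in \<open>auto simp: S_def norm_divide\<close>)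
    then obtain v where v: "norm v < norm w" "Q_rob l w = P_rob l v" by blast
    then show "\<exists>v. norm v < norm w \<and> exp (F w) = halfplane_map a v"
      using FQ [OF w] P_rob_halfplane_map [of v l] RD [OF w] by (auto simp: a_def)
  qed (use R0 R1 a0 F in auto)

  have f: "f holomorphic_on unit_disc" "f 0 = 0" "deriv f 0 = 1" "conv_quot f holomorphic_on unit_disc"
    using assms(3) by (auto simp: robertson_def)
  obtain m where m: "m holomorphic_on unit_disc" "m 0 = 1"
    "\<And>z. z \<in> unit_disc \<Longrightarrow> f z = z * m z"
    "\<And>z. z \<in> unit_disc \<Longrightarrow> star_quot f z = deriv f z / m z"
    using star_quot_factor [OF f(1-3)] by metis
  obtain \<omega> where \<omega>: "\<omega> holomorphic_on ball 0 R" "\<omega> 0 = 0"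
    "\<And>z. z \<in> ball 0 R \<Longrightarrow> norm (\<omega> z) \<le> norm z"
    "\<And>z. z \<in> ball 0 R \<Longrightarrow> m z \<noteq> 0"
    "\<And>z. z \<in> ball 0 R \<Longrightarrow> deriv f z / m z = exp (F (\<omega> z))"
    by (rule dominates_star_quot [OF f(1,3) deriv_nonzero_of_conv_quot [OF f(1,3,4)] m(1-3)])
      (use robertson_conv_quot [OF assms(3) cosl] in \<open>auto simp: a_def\<close>)
  have \<omega>R: "\<omega> z \<in> ball 0 R" if "z \<in> ball 0 R" for z
    using \<omega>(3) [OF that] that by auto
  have eq: "star_quot f z = Q_rob l (\<omega> z)" if "z \<in> ball 0 R" for z
    using \<omega>(5) [OF that] m(4) [OF RD [OF that]] FQ [OF \<omega>R [OF that]] by simp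
  have f_hol: "star_quot f holomorphic_on ball 0 R"
  proof -
    have "(Q_rob l \<circ> \<omega>) holomorphic_on ball 0 R"
      using \<omega>R by (intro holomorphic_on_compose_gen [OF \<omega>(1) Q_hol]) auto
    then show ?thesis by (rule holomorphic_transform) (simp add: eq)
  qed
  have Rz: "of_real R * z \<in> ball 0 R" if "z \<in> unit_disc" for z :: complex
    using that R0 by (simp add: norm_mult)
  note comp = holomorphic_dilation [OF R0]
  show ?thesis
    unfolding subordinate_in_def subordinate_def R_def [symmetric]
  proof (intro conjI exI ballI)
    show "(\<lambda>z. star_quot f (of_real R * z)) holomorphic_on unit_disc"
      by (rule comp [OF f_hol])
    show "(\<lambda>z. star_quot (f_rob l) (of_real R * z)) holomorphic_on unit_disc"
      using comp [OF Q_hol] by (simp add: Q_rob_def)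
    show "(\<lambda>z. \<omega> (of_real R * z) / of_real R) holomorphic_on unit_disc"
      using R0 by (intro holomorphic_intros comp \<omega>(1)) auto
    show "\<omega> (of_real R * 0) / of_real R = 0" by (simp add: \<omega>(2))
    fix z :: complex assume z: "z \<in> unit_disc"
    show "norm (\<omega> (of_real R * z) / of_real R) < 1"
      using \<omega>R [OF Rz [OF z]] R0 by (simp add: norm_divide)
    show "star_quot f (of_real R * z) = star_quot (f_rob l) (of_real R * (\<omega> (of_real R * z) / of_real R))"
      using eq [OF Rz [OF z]] R0 by (simp add: Q_rob_def)
  qed
qed

end
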